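(* For every formal power series $L(z,\bar z,u)\colon\mathbb C^n_z\to\mathbb C^n_{\bar z}\times\mathbb C^d_w$ without constant terms and $f_0(z,u)\in\mathbb C^n$ and $g_0(u)\in\mathbb R^d$ without constant and linear terms, there exist unique formal power series $f(z,\bar z,u)\in\mathbb C^n$, $g(z,\bar z,u)\in\mathbb R^d$ and $\phi(z',\bar z',u')\in\mathbb R^d$ without constant and linear terms satisfying $f(z,0,u)=f_0(z,u)$, $g(0,0,u)=g_0(u)$ and $\phi(z',0,u')=0$, such that the almost CR structure given by $L$ admits the quasi CR embedding at $0$ as the submanifold $M'\subset\mathbb C^n_{z'}\times\mathbb C^d_{w'}$ given by $$\operatorname{Im}w'=\phi(z',\bar z',\operatorname{Re}w')$$ via the map $(z,u)\mapsto(z+f(z,\bar z,u),u+g(z,\bar z,u))$, where $(z',u')$, $u'=\operatorname{Re}w'$, are regarded as intrinsic coordinates on $M'$.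
   Context: Coordinates $(z,u)=(x+iy,u)\in\mathbb C^n\times\mathbb R^d$. The complexified tangent space at each point is identified with $\mathbb C^n_z\times\mathbb C^n_{\bar z}\times\mathbb C^d_w$ (coordinates $dz,d\bar z$, and $dw$ extending $du$). A formal power series $L(z,\bar z,u)=(L^{\bar z},L^w)$ with values complex-linear maps $\mathbb C^n_z\to\mathbb C^n_{\bar z}\times\mathbb C^d_w$ and $L(0)=0$ represents the formal almost CR structure (CR dimension $n$, CR codimension $d$) whose $(1,0)$ bundle is the graph $(d\bar z,dw)=L(z,\bar z,u)\,dz$. Formal power series in $(z,\bar z,u)$ are treated with $z,\bar z$ as independent variables, e.g. in $f(z,0,u)$ and $\phi(z',0,u')$. The map $z'=z+f$, $u'=u+g$ transforms $L$ into the $L'=(L'^{\bar z'},L'^{w'})$ representing the transformed structure in the coordinates $(z',u')$: $$g_z+g_{\bar z}L^{\bar z}+(\mathrm{id}+g_u)L^w=L'^{w'}(\mathrm{id}+f_z+f_{\bar z}L^{\bar z}+f_uL^w),$$ $$\bar f_z+(\mathrm{id}+\bar f_{\bar z})L^{\bar z}+\bar f_uL^w=L'^{\bar z'}(\mathrm{id}+f_z+f_{\bar z}L^{\bar z}+f_uL^w),$$ with $L'$ taken at $(z,\bar z,u)+(f,\bar f,g)(z,\bar z,u)$. The evaluation along the Euler vector field $e(z)=\sum_jz_j\frac{\partial}{\partial z_j}$ is $\tilde L(z,\bar z,u):=L(z,\bar z,u)e(z)$. A quasi CR embedding at a point $p$ of an almost CR structure of CR dimension $n$ and CR codimension $d$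 into $\mathbb C^n\times\mathbb C^d$ is a (formal) embedding as a submanifold $M'\subset\mathbb C^n_{z'}\times\mathbb C^d_{w'}$ with $p=0$, $T_0M'=\mathbb C^n\times\mathbb R^d$, such that the transformed almost CR structure on $M'$ and the CR structure induced on $M'$ by its inclusion in $\mathbb C^{n+d}$ have equal evaluations along the Euler vector field, with $z'$ and $u'=\operatorname{Re}w'$ regarded as intrinsic coordinates on $M'$. (For $M'=\{\operatorname{Im}w'=\phi(z',\bar z',\operatorname{Re}w')\}$ the induced structure is represented by $(0,\,i(\mathrm{id}-i\phi_{u'})^{-1}\phi_{z'})$.) *)

theory Defs
  imports
    Complex_Main
    "HOL-Library.Multiset"
    "HOL-Library.Groups_Big_Fun"
    "Jordan_Normal_Form.Matrix"
begin

section \<open>Formal power series in several variables\<close>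

text \<open>
  A monomial in variables of type \<^typ>\<open>'v\<close> is the finite multiset of its factors, so
  \<^term>\<open>size m\<close> is the total degree and \<^term>\<open>count m v\<close> the exponent of \<^term>\<open>v\<close>.
  A formal power series is an arbitrary assignment of coefficients to monomials.
\<close>

typedef ('v, 'a) mps = "UNIV :: ('v multiset \<Rightarrow> 'a) set"
  morphisms mps_coeff Abs_mps
  by simp

setup_lifting type_definition_mps

lemma mps_eqI: "(\<And>m. mps_coeff p m = mps_coeff q m) \<Longrightarrow> p = q"
  by transfer auto

lemma finite_multiset_splits: "finite {(a, b). a + b = (m :: 'v multiset)}"
proof -
  let ?S = "{xs. set xs \<subseteq> set_mset m \<and> length xs \<le> size m}"
  have fin: "finite ?S"
    by (rule finite_lists_length_le) simp
  have sub: "a \<in> mset ` ?S" if "a \<subseteq># m" for a :: "'v multiset"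
  proof -
    obtain xs where xs: "mset xs = a" using ex_mset by blast
    have "set xs \<subseteq> set_mset m" using xs that by (metis set_mset_mono set_mset_mset)
    moreover have "length xs \<le> size m" using xs that by (metis size_mset size_mset_mono)
    ultimately show ?thesis using xs by blast
  qed
  have "{(a, b). a + b = m} \<subseteq> mset ` ?S \<times> mset ` ?S"
    using sub by (auto simp: mset_subset_eq_add_left mset_subset_eq_add_right)
  then show ?thesis
    using fin by (meson finite_SigmaI finite_imageI finite_subset)
qed

instantiation mps :: (type, comm_ring_1) comm_ring_1
begin

lift_definition zero_mps :: "('a, 'b) mps" is "\<lambda>_. 0" .
lift_definition one_mps :: "('a, 'b) mps" is "\<lambda>m. if m = {#} then 1 else 0" .
lift_definition plus_mps :: "('a, 'b) mps \<Rightarrow> ('a, 'b) mps \<Rightarrow> ('a, 'b) mps" is "\<lambda>p q m. p m + q m" .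
lift_definition minus_mps :: "('a, 'b) mps \<Rightarrow> ('a, 'b) mps \<Rightarrow> ('a, 'b) mps" is "\<lambda>p q m. p m - q m" .
lift_definition uminus_mps :: "('a, 'b) mps \<Rightarrow> ('a, 'b) mps" is "\<lambda>p m. - p m" .
lift_definition times_mps :: "('a, 'b) mps \<Rightarrow> ('a, 'b) mps \<Rightarrow> ('a, 'b) mps"
  is "\<lambda>p q m. \<Sum>(a, b) | a + b = m. p a * q b" .

instance
proof
  fix p q r :: "('a, 'b) mps"
  show "p + q + r = p + (q + r)" "p + q = q + p" "0 + p = p" "- p + p = 0" "p - q = p + - q"
    by (transfer; simp add: algebra_simps)+
  show "(0 :: ('a, 'b) mps) \<noteq> 1"
    by transfer (metis zero_neq_one)
  show "(p + q) * r = p * r + q * r"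
    by transfer (simp add: distrib_right sum.distrib case_prod_beta)
  show "p * q = q * p"
  proof (transfer, rule ext)
    fix p q :: "'a multiset \<Rightarrow> 'b" and m
    show "(\<Sum>(a, b) | a + b = m. p a * q b) = (\<Sum>(a, b) | a + b = m. q a * p b)"
      by (rule sum.reindex_bij_witness[of _ "\<lambda>(a, b). (b, a)" "\<lambda>(a, b). (b, a)"])
         (auto simp: mult.commute add.commute)
  qed
  show "1 * p = p"
  proof (transfer, rule ext)
    fix p :: "'a multiset \<Rightarrow> 'b" and m
    let ?g = "\<lambda>(a :: 'a multiset, b). (if a = {#} then 1 else 0) * p b"
    have "sum ?g {(a, b). a + b = m} = sum ?g {({#}, m)}"
      by (rule sum.mono_neutral_right) (auto simp: finite_multiset_splits split: if_splits)
    then show "(\<Sum>(a, b) | a + b = m. (if a = {#} then 1 else 0) * p b) = p m"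
      by simp
  qed
  show "p * q * r = p * (q * r)"
  proof (transfer, rule ext)
    fix p q r :: "'a multiset \<Rightarrow> 'b" and m
    let ?D = "\<lambda>m :: 'a multiset. {(a, b). a + b = m}"
    have "(\<Sum>(a, b) \<in> ?D m. (\<Sum>(c, d) \<in> ?D a. p c * q d) * r b)
        = (\<Sum>x \<in> ?D m. \<Sum>y \<in> ?D (fst x). p (fst y) * q (snd y) * r (snd x))"
      by (simp add: sum_distrib_right case_prod_beta)
    also have "\<dots> = (\<Sum>(x, y) \<in> (SIGMA x : ?D m. ?D (fst x)). p (fst y) * q (snd y) * r (snd x))"
      by (rule sum.Sigma) (auto simp: finite_multiset_splits)
    also have "\<dots> = (\<Sum>(x, y) \<in> (SIGMA x : ?D m. ?D (snd x)). p (fst x) * (q (fst y) * r (snd y)))"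
      by (rule sum.reindex_bij_witness
            [of _ "\<lambda>((a, b), (c, d)). ((a + c, d), (a, c))" "\<lambda>((a, b), (c, d)). ((c, d + b), (d, b))"])
         (auto simp: algebra_simps)
    also have "\<dots> = (\<Sum>x \<in> ?D m. \<Sum>y \<in> ?D (snd x). p (fst x) * (q (fst y) * r (snd y)))"
      by (rule sum.Sigma[symmetric]) (auto simp: finite_multiset_splits)
    also have "\<dots> = (\<Sum>(a, b) \<in> ?D m. p a * (\<Sum>(c, d) \<in> ?D b. q c * r d))"
      by (simp add: sum_distrib_left case_prod_beta)
    finally show "(\<Sum>(a, b) \<in> ?D m. (\<Sum>(c, d) \<in> ?D a. p c * q d) * r b)
        = (\<Sum>(a, b) \<in> ?D m. p a * (\<Sum>(c, d) \<in> ?D b. q c * r d))" .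
  qed
qed

end

lift_definition mps_const :: "'a \<Rightarrow> ('v, 'a :: zero) mps"
  is "\<lambda>c m. if m = {#} then c else 0" .

lift_definition mps_var :: "'v \<Rightarrow> ('v, 'a :: zero_neq_one) mps"
  is "\<lambda>v m. if m = {#v#} then 1 else 0" .

lift_definition mps_deriv :: "'v \<Rightarrow> ('v, 'a :: semiring_1) mps \<Rightarrow> ('v, 'a) mps"
  is "\<lambda>v p m. of_nat (count m v + 1) * p (add_mset v m)" .

text \<open>Setting all variables in \<open>X\<close> to zero: the monomials containing one of them disappear.\<close>

lift_definition mps_set_zero :: "'v set \<Rightarrow> ('v, 'a :: zero) mps \<Rightarrow> ('v, 'a) mps"
  is "\<lambda>X p m. if set_mset m \<inter> X = {} then p m else 0" .

text \<open>
  Substitution of \<open>F v\<close> for every variable \<open>v\<close>: a coefficient of the composition is the sum of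
  the coefficients of all the \<open>p\<^sub>a F\<^sup>a\<close>. Only finitely many of these contribute whenever \<open>p\<close>
  involves finitely many variables and the series substituted for them have no constant terms.
  (In general, \<^const>\<open>Sum_any\<close> returns 0 if there are infinitely many nonzero summands.)
\<close>

definition mps_subst ::
  "('v \<Rightarrow> ('w, 'a) mps) \<Rightarrow> ('v, 'a) mps \<Rightarrow> ('w, 'a :: comm_ring_1) mps" where
  "mps_subst F p =
    Abs_mps (\<lambda>m. Sum_any (\<lambda>a. mps_coeff p a * mps_coeff (\<Prod>v\<in>#a. F v) m))"

definition mps_in :: "'v set \<Rightarrow> ('v, 'a :: zero) mps set" where
  "mps_in V = {p. \<forall>m. mps_coeff p m \<noteq> 0 \<longrightarrow> set_mset m \<subseteq> V}"

definition no_constant_term :: "('v, 'a :: zero) mps \<Rightarrow> bool" where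
  "no_constant_term p \<longleftrightarrow> mps_coeff p {#} = 0"

definition no_constant_linear_terms :: "('v, 'a :: zero) mps \<Rightarrow> bool" where
  "no_constant_linear_terms p \<longleftrightarrow> (\<forall>m. size m \<le> 1 \<longrightarrow> mps_coeff p m = 0)"


section \<open>Formal power series in $(z, \bar z, u)$\<close>

text \<open>
  \<open>Z j\<close>, \<open>Zbar j\<close> are independent variables. Coordinates are numbered from 0, and
  only \<open>Z j\<close>, \<open>Zbar j\<close> with \<open>j < n\<close> and \<open>U k\<close> with \<open>k < d\<close> are used when the CR dimension is \<open>n\<close>
  and the CR codimension is \<open>d\<close> (both may be 0; \<open>d = 0\<close> is the almost complex case). Series in the
  coordinates $(z', \bar z', u')$ are written in the same variables.
\<close>

datatype cr_var = Z nat | Zbar nat | U nat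

type_synonym cr_series = "(cr_var, complex) mps"

definition z_vars :: "nat \<Rightarrow> cr_var set" where "z_vars n = Z ` {..<n}"
definition zbar_vars :: "nat \<Rightarrow> cr_var set" where "zbar_vars n = Zbar ` {..<n}"
definition u_vars :: "nat \<Rightarrow> cr_var set" where "u_vars d = U ` {..<d}"

definition cr_vars :: "nat \<Rightarrow> nat \<Rightarrow> cr_var set" where
  "cr_vars n d = z_vars n \<union> zbar_vars n \<union> u_vars d"

fun conj_var :: "cr_var \<Rightarrow> cr_var" where
  "conj_var (Z j) = Zbar j"
| "conj_var (Zbar j) = Z j"
| "conj_var (U k) = U k"

text \<open>
  The conjugate series $\bar f$: coefficients are conjugated and the roles of $z$ and $\bar z$ are
  exchanged. A series is real-valued (takes values in $\mathbb{R}$ when $\bar z$ is the conjugate of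
  $z$ and $u$ is real) iff it equals its conjugate.
\<close>

lift_definition cr_conj :: "cr_series \<Rightarrow> cr_series"
  is "\<lambda>p m. cnj (p (image_mset conj_var m))" .

definition real_valued :: "cr_series \<Rightarrow> bool" where
  "real_valued p \<longleftrightarrow> cr_conj p = p"

definition vec_series :: "nat \<Rightarrow> cr_var set \<Rightarrow> cr_series vec set" where
  "vec_series k V = {h \<in> carrier_vec k. \<forall>i<k. h $ i \<in> mps_in V}"

definition real_vec_series :: "nat \<Rightarrow> cr_var set \<Rightarrow> cr_series vec set" where
  "real_vec_series k V = {h \<in> vec_series k V. \<forall>i<k. real_valued (h $ i)}"

definition mat_series :: "nat \<Rightarrow> nat \<Rightarrow> cr_var set \<Rightarrow> cr_series mat set" where
  "mat_series k l V = {A \<in> carrier_mat k l. \<forall>i<k. \<forall>j<l. A $$ (i, j) \<in> mps_in V}"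

definition vec_no_constant_linear_terms :: "cr_series vec \<Rightarrow> bool" where
  "vec_no_constant_linear_terms h \<longleftrightarrow> (\<forall>i<dim_vec h. no_constant_linear_terms (h $ i))"

definition mat_no_constant_term :: "cr_series mat \<Rightarrow> bool" where
  "mat_no_constant_term A \<longleftrightarrow>
    (\<forall>i<dim_row A. \<forall>j<dim_col A. no_constant_term (A $$ (i, j)))"

definition jac_z :: "nat \<Rightarrow> cr_series vec \<Rightarrow> cr_series mat" where
  "jac_z n h = mat (dim_vec h) n (\<lambda>(i, j). mps_deriv (Z j) (h $ i))"

definition jac_zbar :: "nat \<Rightarrow> cr_series vec \<Rightarrow> cr_series mat" where
  "jac_zbar n h = mat (dim_vec h) n (\<lambda>(i, j). mps_deriv (Zbar j) (h $ i))"

definition jac_u :: "nat \<Rightarrow> cr_series vec \<Rightarrow> cr_series mat" where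
  "jac_u d h = mat (dim_vec h) d (\<lambda>(i, j). mps_deriv (U j) (h $ i))"


section \<open>Formal almost CR structures\<close>

text \<open>
  \<open>(Lb, Lw)\<close> stands for $L = (L^{\bar z}, L^w)$, with values linear maps
  $\mathbb{C}^n_z \to \mathbb{C}^n_{\bar z} \times \mathbb{C}^d_w$ and $L(0) = 0$.
\<close>

definition formal_almost_CR :: "nat \<Rightarrow> nat \<Rightarrow> cr_series mat \<Rightarrow> cr_series mat \<Rightarrow> bool" where
  "formal_almost_CR n d Lb Lw \<longleftrightarrow>
    Lb \<in> mat_series n n (cr_vars n d) \<and> mat_no_constant_term Lb \<and>
    Lw \<in> mat_series d n (cr_vars n d) \<and> mat_no_constant_term Lw"

text \<open>The substitution of $(z, \bar z, u) + (f, \bar f, g)(z, \bar z, u)$ for $(z, \bar z, u)$.\<close>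

definition along_map :: "cr_series vec \<Rightarrow> cr_series vec \<Rightarrow> cr_series \<Rightarrow> cr_series" where
  "along_map f g = mps_subst (\<lambda>v. case v of
      Z j \<Rightarrow> mps_var (Z j) + f $ j
    | Zbar j \<Rightarrow> mps_var (Zbar j) + cr_conj (f $ j)
    | U k \<Rightarrow> mps_var (U k) + g $ k)"

text \<open>\<open>(Lb', Lw')\<close> represents \<open>(Lb, Lw)\<close> in the coordinates $z' = z + f$, $u' = u + g$.\<close>

definition transforms_to ::
  "nat \<Rightarrow> nat \<Rightarrow> cr_series vec \<Rightarrow> cr_series vec \<Rightarrow>
   cr_series mat \<Rightarrow> cr_series mat \<Rightarrow> cr_series mat \<Rightarrow> cr_series mat \<Rightarrow> bool" where
  "transforms_to n d f g Lb Lw Lb' Lw' \<longleftrightarrow>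
    (let fb = map_vec cr_conj f;
         dz' = 1\<^sub>m n + jac_z n f + jac_zbar n f * Lb + jac_u d f * Lw
     in
       jac_z n g + jac_zbar n g * Lb + (1\<^sub>m d + jac_u d g) * Lw
         = map_mat (along_map f g) Lw' * dz' \<and>
       jac_z n fb + (1\<^sub>m n + jac_zbar n fb) * Lb + jac_u d fb * Lw
         = map_mat (along_map f g) Lb' * dz')"

definition euler_field :: "nat \<Rightarrow> cr_series vec" where
  "euler_field n = vec n (\<lambda>j. mps_var (Z j))"

definition mat_inv :: "'a :: comm_ring_1 mat \<Rightarrow> 'a mat" where
  "mat_inv A = (THE B. B \<in> carrier_mat (dim_col A) (dim_row A) \<and> inverts_mat A B \<and> inverts_mat B A)"

text \<open>
  The $w$-component of the CR structure induced on
  $\{\mathrm{Im}\, w' = \phi(z', \bar z', \mathrm{Re}\, w')\}$ by the inclusion in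
  $\mathbb{C}^{n+d}$; its $\bar z$-component is 0. The matrix being inverted is invertible
  because $\phi$ has no linear terms.
\<close>

definition induced_w :: "nat \<Rightarrow> nat \<Rightarrow> cr_series vec \<Rightarrow> cr_series mat" where
  "induced_w n d \<phi> =
    mps_const \<i> \<cdot>\<^sub>m (mat_inv (1\<^sub>m d - mps_const \<i> \<cdot>\<^sub>m jac_u d \<phi>) * jac_z n \<phi>)"

text \<open>
  The map $(z, u) \mapsto (z + f, u + g)$ is a quasi CR embedding at 0 of the structure \<open>(Lb, Lw)\<close>
  as $M' = \{\mathrm{Im}\, w' = \phi(z', \bar z', \mathrm{Re}\, w')\}$. Since $f$ and $g$ have no
  constant or linear terms, the map sends 0 to 0 and is formally invertible, so the transformed
  structure \<open>(Lb', Lw')\<close> is uniquely determined; since $\phi$ has no constant or linear terms,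
  $0 \in M'$ and $T_0 M' = \mathbb{C}^n \times \mathbb{R}^d$.
\<close>

definition quasi_CR_embedding ::
  "nat \<Rightarrow> nat \<Rightarrow> cr_series mat \<Rightarrow> cr_series mat \<Rightarrow>
   cr_series vec \<Rightarrow> cr_series vec \<Rightarrow> cr_series vec \<Rightarrow> bool" where
  "quasi_CR_embedding n d Lb Lw f g \<phi> \<longleftrightarrow>
    f \<in> vec_series n (cr_vars n d) \<and> vec_no_constant_linear_terms f \<and>
    g \<in> real_vec_series d (cr_vars n d) \<and> vec_no_constant_linear_terms g \<and>
    \<phi> \<in> real_vec_series d (cr_vars n d) \<and> vec_no_constant_linear_terms \<phi> \<and>
    (\<exists>Lb' Lw'.
      formal_almost_CR n d Lb' Lw' \<and>
      transforms_to n d f g Lb Lw Lb' Lw' \<and>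
      Lb' *\<^sub>v euler_field n = 0\<^sub>v n \<and>
      Lw' *\<^sub>v euler_field n = induced_w n d \<phi> *\<^sub>v euler_field n)"

end

theory Submission
  imports Defs
begin

text \<open>
  Write $h = g - i \phi$, $P = L'^{\bar z'} - \bar f_z$ and $Q = L'^{w'} - h_z - I(\phi)$, where
  $I(\phi)$ is the structure induced on $M'$. In the coordinates of $M'$ the two conditions on the
  evaluations along the Euler field $e$ become $e(\bar f) = -P e$ and $e(h) = -Q e$. Their right-hand
  sides vanish at $z = 0$, so dividing every coefficient by its degree in $z$ solves them; the terms free
  of $z$ are fixed by $f_0$, by $g_0$ and by the reality of $g$ and $\phi$. Hence $f$, $g$, $\phi$ are
  functions of $(P, Q)$, their terms of degree at most $k + 1$ depending only on the terms of $(P, Q)$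
  of degree at most $k$. What remains is the transformation rule, an equation $(P, Q) = \Psi(P, Q)$.
  All leading terms cancel in $\Psi$, because $L$ and $L'$ vanish at 0 and the map is tangent to the
  identity, so $\Psi$ is a contraction for the degree filtration and has exactly one fixed point.
\<close>

text \<open>The obstacle is loss of derivatives: the rule contains first derivatives of conj f and g
  at leading order, and agreement of f below degree k + 1 yields agreement of f_z only below degree
  k. With (P, Q) as unknown, exactly those bare derivatives move to the other side. What is left
  gains a degree for one of three reasons: a derivative is multiplied by L, which vanishes at 0; two
  factors vanishing at 0 are multiplied; or a series is compared with its composition with a map
  tangent to the identity. The combination h = g - i \<phi> comes from the induced structure:
  I(\<phi>) is i \<phi>_z to leading order and g_z = h_z + i \<phi>_z, so only the remainder i
  \<phi>_z - I(\<phi>) is left over, in which every term contains two derivatives of \<phi>.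
  Subtracting all of I(\<phi>) in Q keeps the Euler equation for h exactly linear. One complex
  equation for h yields two real series: at a monomial with both z and zbar, h is prescribed there
  and at the conjugate monomial, which separates g from \<phi>; at all other monomials \<phi>
  vanishes.\<close>

lemmas mps_coeff_simps [simp] =
  zero_mps.rep_eq one_mps.rep_eq plus_mps.rep_eq minus_mps.rep_eq uminus_mps.rep_eq
  mps_const.rep_eq mps_var.rep_eq mps_deriv.rep_eq mps_set_zero.rep_eq cr_conj.rep_eq

lemma mps_coeff_Abs [simp]: "mps_coeff (Abs_mps c) = c"
  by (simp add: Abs_mps_inverse)

lemma mps_eq_iff: "p = q \<longleftrightarrow> (\<forall>m. mps_coeff p m = mps_coeff q m)"
  using mps_eqI by blast

lemma mps_coeff_sum [simp]: "mps_coeff (sum h A) m = (\<Sum>x\<in>A. mps_coeff (h x) m)"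
  by (induction A rule: infinite_finite_induct) auto

lemma mps_coeff_const_mult [simp]: "mps_coeff (mps_const c * p) m = c * mps_coeff p m"
  for p :: "('v, 'a :: comm_ring_1) mps"
proof -
  let ?g = "\<lambda>(a :: 'v multiset, b). (if a = {#} then c else 0) * mps_coeff p b"
  have "sum ?g {(a, b). a + b = m} = sum ?g {({#}, m)}"
    by (rule sum.mono_neutral_right) (auto simp: finite_multiset_splits split: if_splits)
  then show ?thesis
    by (simp add: times_mps.rep_eq)
qed

lemma mps_coeff_var_mult:
  "mps_coeff (mps_var v * p) m = (if v \<in># m then mps_coeff p (m - {#v#}) else 0)"
  for p :: "('v, 'a :: comm_ring_1) mps"
proof -
  let ?g = "\<lambda>(a, b). (if a = {#v#} then 1 else 0) * mps_coeff p b"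
  have "sum ?g {(a, b). a + b = m} = sum ?g (if v \<in># m then {({#v#}, m - {#v#})} else {})"
    by (rule sum.mono_neutral_right) (auto simp: finite_multiset_splits split: if_splits)
  then show ?thesis
    by (simp add: times_mps.rep_eq)
qed

lemma mps_coeff_var_mult_deriv:
  "mps_coeff (mps_var v * mps_deriv v p) m = of_nat (count m v) * mps_coeff p m"
proof (cases "v \<in># m")
  case True
  then have "Suc (count m v - Suc 0) = count m v"
    by (simp add: Suc_leI)
  with True show ?thesis
    by (simp add: mps_coeff_var_mult del: of_nat_Suc flip: of_nat_Suc)
next
  case False
  then have "count m v = 0"
    by (simp add: not_in_iff)
  with False show ?thesis
    by (simp add: mps_coeff_var_mult)
qed

lemma mps_deriv_diff: "mps_deriv v (p - q) = mps_deriv v p - mps_deriv v (q :: ('v, 'a :: comm_ring_1) mps)"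
  by (rule mps_eqI) (simp add: algebra_simps)


section \<open>The degree filtration\<close>

text \<open>The support condition is bundled with the order because substitution is controlled by
  finiteness: with \<open>V\<close> finite, only finitely many monomials lie below a given
  degree.\<close>

definition mps_ord :: "'v set \<Rightarrow> nat \<Rightarrow> ('v, 'a :: zero) mps set" where
  "mps_ord V k = {p. \<forall>m. mps_coeff p m \<noteq> 0 \<longrightarrow> set_mset m \<subseteq> V \<and> k \<le> size m}"

lemma mps_ordI: "(\<And>m. mps_coeff p m \<noteq> 0 \<Longrightarrow> set_mset m \<subseteq> V \<and> k \<le> size m) \<Longrightarrow> p \<in> mps_ord V k"
  by (simp add: mps_ord_def)

lemma mps_ordD: "p \<in> mps_ord V k \<Longrightarrow> mps_coeff p m \<noteq> 0 \<Longrightarrow> set_mset m \<subseteq> V \<and> k \<le> size m"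
  by (simp add: mps_ord_def)

lemma mps_in_eq_ord: "mps_in V = mps_ord V 0"
  by (simp add: mps_in_def mps_ord_def)

lemma mps_ord_1_iff: "p \<in> mps_ord V 1 \<longleftrightarrow> p \<in> mps_in V \<and> no_constant_term p"
  by (auto simp: mps_ord_def mps_in_def no_constant_term_def Suc_le_eq simp flip: nonempty_has_size)

lemma mps_ord_2_iff: "p \<in> mps_ord V 2 \<longleftrightarrow> p \<in> mps_in V \<and> no_constant_linear_terms p"
  by (auto simp: mps_ord_def mps_in_def no_constant_linear_terms_def)
    (metis not_less_eq_eq numeral_2_eq_2)

lemma mps_ord_mono: "p \<in> mps_ord V k \<Longrightarrow> l \<le> k \<Longrightarrow> p \<in> mps_ord V l"
  by (auto simp: mps_ord_def)

lemma zero_mps_ord [simp]: "0 \<in> mps_ord V k"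
  by (simp add: mps_ord_def)

lemma one_mps_ord [simp]: "1 \<in> mps_ord V 0"
  by (simp add: mps_ord_def)

lemma mps_var_ord: "v \<in> V \<Longrightarrow> mps_var v \<in> mps_ord V 1"
  by (simp add: mps_ord_def)

lemma mps_ord_add: "p \<in> mps_ord V k \<Longrightarrow> q \<in> mps_ord V k \<Longrightarrow> p + q \<in> mps_ord V k"
  for p :: "('v, 'a :: comm_ring_1) mps"
  unfolding mps_ord_def by simp (metis add_0)

lemma mps_ord_diff: "p \<in> mps_ord V k \<Longrightarrow> q \<in> mps_ord V k \<Longrightarrow> p - q \<in> mps_ord V k"
  for p :: "('v, 'a :: comm_ring_1) mps"
  unfolding mps_ord_def by simp (metis diff_0)

lemma mps_ord_uminus: "p \<in> mps_ord V k \<Longrightarrow> - p \<in> mps_ord V k"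
  for p :: "('v, 'a :: comm_ring_1) mps"
  by (simp add: mps_ord_def)

lemma mps_ord_sum: "(\<And>x. x \<in> A \<Longrightarrow> h x \<in> mps_ord V k) \<Longrightarrow> sum h A \<in> mps_ord V k"
  for h :: "'b \<Rightarrow> ('v, 'a :: comm_ring_1) mps"
  by (induction A rule: infinite_finite_induct) (auto intro: mps_ord_add)

lemma mps_ord_mult:
  fixes p :: "('v, 'a :: comm_ring_1) mps"
  assumes "p \<in> mps_ord V k" "q \<in> mps_ord V l"
  shows "p * q \<in> mps_ord V (k + l)"
proof (rule mps_ordI)
  fix m assume "mps_coeff (p * q) m \<noteq> 0"
  then have "(\<Sum>(a, b) | a + b = m. mps_coeff p a * mps_coeff q b) \<noteq> 0"
    by (simp add: times_mps.rep_eq)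
  then obtain a b where "a + b = m" "mps_coeff p a * mps_coeff q b \<noteq> 0"
    by (rule sum.not_neutral_contains_not_neutral) auto
  moreover from this have "mps_coeff p a \<noteq> 0" "mps_coeff q b \<noteq> 0"
    by auto
  ultimately show "set_mset m \<subseteq> V \<and> k + l \<le> size m"
    using mps_ordD[OF assms(1)] mps_ordD[OF assms(2)] by fastforce
qed

lemma mps_ord_const_mult: "p \<in> mps_ord V k \<Longrightarrow> mps_const c * p \<in> mps_ord V k"
  for p :: "('v, 'a :: comm_ring_1) mps"
  unfolding mps_ord_def by simp (metis mult_zero_right)

lemma mps_ord_deriv: "p \<in> mps_ord V (Suc k) \<Longrightarrow> mps_deriv v p \<in> mps_ord V k"
  for p :: "('v, 'a :: comm_ring_1) mps"
proof (rule mps_ordI)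
  fix m assume "p \<in> mps_ord V (Suc k)" "mps_coeff (mps_deriv v p) m \<noteq> 0"
  moreover from this have "mps_coeff p (add_mset v m) \<noteq> 0"
    by auto
  ultimately show "set_mset m \<subseteq> V \<and> k \<le> size m"
    using mps_ordD by fastforce
qed

text \<open>Telescoping: exchanging the factors \<open>F v\<close> for \<open>G v\<close> one at a
  time, each exchange trades a factor of order 1 for a difference of order
  \<open>l + 1\<close>.\<close>

lemma mps_ord_prod_diff:
  fixes F G :: "'v \<Rightarrow> ('v, 'a :: comm_ring_1) mps"
  assumes "\<And>v. v \<in> V \<Longrightarrow> F v \<in> mps_ord V 1 \<and> G v \<in> mps_ord V 1 \<and> F v - G v \<in> mps_ord V (Suc l)"
    and "set_mset a \<subseteq> V"
  shows "(\<Prod>v\<in>#a. F v) \<in> mps_ord V (size a)"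
    and "(\<Prod>v\<in>#a. F v) - (\<Prod>v\<in>#a. G v) \<in> mps_ord V (size a + l)"
proof -
  have "(\<Prod>v\<in>#a. F v) \<in> mps_ord V (size a) \<and>
    (\<Prod>v\<in>#a. F v) - (\<Prod>v\<in>#a. G v) \<in> mps_ord V (size a + l)"
    using assms(2)
  proof (induction a)
    case (add v a)
    define A B where "A = (\<Prod>v\<in>#a. F v)" and "B = (\<Prod>v\<in>#a. G v)"
    have IH: "A \<in> mps_ord V (size a)" "A - B \<in> mps_ord V (size a + l)"
      and v: "F v \<in> mps_ord V 1" "G v \<in> mps_ord V 1" "F v - G v \<in> mps_ord V (Suc l)"
      using add assms(1)[of v] by (auto simp: A_def B_def)
    have "F v * A - G v * B = (F v - G v) * A + G v * (A - B)"
      by (simp add: algebra_simps)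
    also have "\<dots> \<in> mps_ord V (Suc (size a) + l)"
      using mps_ord_mult[OF v(3) IH(1)] mps_ord_mult[OF v(2) IH(2)]
      by (simp add: mps_ord_add ac_simps)
    finally show ?case
      using mps_ord_mult[OF v(1) IH(1)] by (simp add: A_def B_def)
  qed simp
  then show "(\<Prod>v\<in>#a. F v) \<in> mps_ord V (size a)"
    and "(\<Prod>v\<in>#a. F v) - (\<Prod>v\<in>#a. G v) \<in> mps_ord V (size a + l)"
    by auto
qed

lemma finite_monomials: "finite V \<Longrightarrow> finite {a. set_mset a \<subseteq> V \<and> size a \<le> N}"
proof -
  assume "finite V"
  then have "finite (mset ` {xs. set xs \<subseteq> V \<and> length xs \<le> N})"
    by (intro finite_imageI finite_lists_length_le)
  moreover have "{a. set_mset a \<subseteq> V \<and> size a \<le> N} \<subseteq> mset ` {xs. set xs \<subseteq> V \<and> length xs \<le> N}"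
  proof
    fix a assume "a \<in> {a. set_mset a \<subseteq> V \<and> size a \<le> N}"
    moreover obtain xs where "mset xs = a"
      using ex_mset by blast
    ultimately show "a \<in> mset ` {xs. set xs \<subseteq> V \<and> length xs \<le> N}"
      by auto
  qed
  ultimately show ?thesis
    by (rule finite_subset[rotated])
qed

text \<open>The product over \<open>a\<close> has order at least \<open>size a\<close>, so only
  monomials of degree at most \<open>size m\<close> contribute. Thus \<open>Sum_any\<close> is a
  genuine finite sum here, and its default value for infinite supports is not at issue.\<close>

lemma mps_coeff_subst:
  fixes F :: "'v \<Rightarrow> ('v, 'a :: comm_ring_1) mps"
  assumes "finite V" "p \<in> mps_in V" "\<And>v. v \<in> V \<Longrightarrow> F v \<in> mps_ord V 1"
  shows "mps_coeff (mps_subst F p) m =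
    (\<Sum>a | set_mset a \<subseteq> V \<and> size a \<le> size m. mps_coeff p a * mps_coeff (\<Prod>v\<in>#a. F v) m)"
proof -
  have "{a. mps_coeff p a * mps_coeff (\<Prod>v\<in>#a. F v) m \<noteq> 0} \<subseteq> {a. set_mset a \<subseteq> V \<and> size a \<le> size m}"
  proof safe
    fix a v assume *: "mps_coeff p a * mps_coeff (\<Prod>v\<in>#a. F v) m \<noteq> 0"
    then have "mps_coeff p a \<noteq> 0" "mps_coeff (\<Prod>v\<in>#a. F v) m \<noteq> 0"
      by auto
    then have a: "set_mset a \<subseteq> V"
      using assms(2) by (auto simp: mps_in_def)
    then show "v \<in># a \<Longrightarrow> v \<in> V"
      by auto
    show "size a \<le> size m"
      using mps_ord_prod_diff(1)[of V F F 0, OF _ a] assms(3) mps_ordD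
        \<open>mps_coeff (\<Prod>v\<in>#a. F v) m \<noteq> 0\<close> by fastforce
  qed
  then show ?thesis
    unfolding mps_subst_def
    by (simp add: Sum_any.expand_superset[OF finite_monomials[OF assms(1)]])
qed

lemma mps_subst_diff:
  fixes F :: "'v \<Rightarrow> ('v, 'a :: comm_ring_1) mps"
  assumes "finite V" "p \<in> mps_in V" "q \<in> mps_in V" "\<And>v. v \<in> V \<Longrightarrow> F v \<in> mps_ord V 1"
  shows "mps_subst F (p - q) = mps_subst F p - mps_subst F q"
proof -
  have "p - q \<in> mps_in V"
    using assms by (simp add: mps_in_eq_ord mps_ord_diff)
  then show ?thesis
    using assms
    by (intro mps_eqI) (simp add: mps_coeff_subst sum_subtractf algebra_simps)
qed

text \<open>A monomial \<open>a\<close> of \<open>p\<close> has size at least \<open>k\<close>; its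
  image keeps order \<open>size a\<close>, and passing from \<open>F\<close> to \<open>G\<close>
  changes that image only from order \<open>size a + l\<close> on.\<close>

lemma mps_subst_ord:
  fixes F G :: "'v \<Rightarrow> ('v, 'a :: comm_ring_1) mps"
  assumes V: "finite V" and p: "p \<in> mps_ord V k"
    and F: "\<And>v. v \<in> V \<Longrightarrow> F v \<in> mps_ord V 1 \<and> G v \<in> mps_ord V 1 \<and> F v - G v \<in> mps_ord V (Suc l)"
  shows "mps_subst F p \<in> mps_ord V k"
    and "mps_subst F p - mps_subst G p \<in> mps_ord V (k + l)"
proof -
  have p0: "p \<in> mps_in V"
    using p mps_ord_mono by (auto simp: mps_in_eq_ord)
  note coeff = mps_coeff_subst[OF V p0]
  show "mps_subst F p \<in> mps_ord V k"
  proof (rule mps_ordI)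
    fix m assume "mps_coeff (mps_subst F p) m \<noteq> 0"
    with F have "(\<Sum>a | set_mset a \<subseteq> V \<and> size a \<le> size m.
        mps_coeff p a * mps_coeff (\<Prod>v\<in>#a. F v) m) \<noteq> 0"
      by (simp add: coeff)
    then obtain a where a: "set_mset a \<subseteq> V" "mps_coeff p a * mps_coeff (\<Prod>v\<in>#a. F v) m \<noteq> 0"
      by (rule sum.not_neutral_contains_not_neutral) auto
    then have "mps_coeff p a \<noteq> 0" "mps_coeff (\<Prod>v\<in>#a. F v) m \<noteq> 0"
      by auto
    then show "set_mset m \<subseteq> V \<and> k \<le> size m"
      using mps_ordD[OF p] mps_ordD[OF mps_ord_prod_diff(1)[OF F a(1)]] by fastforce
  qed
  show "mps_subst F p - mps_subst G p \<in> mps_ord V (k + l)"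
  proof (rule mps_ordI)
    fix m assume "mps_coeff (mps_subst F p - mps_subst G p) m \<noteq> 0"
    with F have "(\<Sum>a | set_mset a \<subseteq> V \<and> size a \<le> size m.
        mps_coeff p a * mps_coeff ((\<Prod>v\<in>#a. F v) - (\<Prod>v\<in>#a. G v)) m) \<noteq> 0"
      by (simp add: coeff sum_subtractf algebra_simps)
    then obtain a where a: "set_mset a \<subseteq> V"
        "mps_coeff p a * mps_coeff ((\<Prod>v\<in>#a. F v) - (\<Prod>v\<in>#a. G v)) m \<noteq> 0"
      by (rule sum.not_neutral_contains_not_neutral) auto
    then have "mps_coeff p a \<noteq> 0" "mps_coeff ((\<Prod>v\<in>#a. F v) - (\<Prod>v\<in>#a. G v)) m \<noteq> 0"
      by (auto simp del: minus_mps.rep_eq)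
    then show "set_mset m \<subseteq> V \<and> k + l \<le> size m"
      using mps_ordD[OF p] mps_ordD[OF mps_ord_prod_diff(2)[OF F a(1)]] by fastforce
  qed
qed

lemma mps_coeff_prod_var: "mps_coeff (\<Prod>v\<in>#a. mps_var v) m = (if m = a then 1 else (0 :: 'a :: comm_ring_1))"
proof (induction a arbitrary: m)
  case (add v a)
  then show ?case
    by (auto simp: mps_coeff_var_mult)
qed auto

lemma mps_subst_var:
  assumes "finite V" "p \<in> mps_in V"
  shows "mps_subst mps_var p = (p :: ('v, 'a :: comm_ring_1) mps)"
proof (rule mps_eqI)
  fix m
  have "mps_coeff p m = 0" if "\<not> set_mset m \<subseteq> V"
    using that assms(2) by (auto simp: mps_in_def)
  moreover have "mps_coeff (mps_subst mps_var p) m =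
      (\<Sum>a | set_mset a \<subseteq> V \<and> size a \<le> size m. if m = a then mps_coeff p a else 0)"
    by (subst mps_coeff_subst[OF assms mps_var_ord]) (auto simp: mps_coeff_prod_var intro!: sum.cong)
  ultimately show "mps_coeff (mps_subst mps_var p) m = mps_coeff p m"
    using assms(1) by (simp add: finite_monomials)
qed


section \<open>Congruence of series modulo high degree\<close>

text \<open>Two indices are carried because gains come from products: \<open>a\<close> bounds the
  order of vanishing of both series, \<open>k\<close> is the degree below which they agree, and the
  \<open>a\<close> of one factor raises the \<open>k\<close> of the other.\<close>

definition scong :: "'v set \<Rightarrow> nat \<Rightarrow> nat \<Rightarrow> ('v, 'a :: comm_ring_1) mps \<Rightarrow> ('v, 'a) mps \<Rightarrow> bool" where
  "scong V a k p q \<longleftrightarrow> p \<in> mps_ord V a \<and> q \<in> mps_ord V a \<and> p - q \<in> mps_ord V k"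

lemma scong_refl: "p \<in> mps_ord V a \<Longrightarrow> scong V a k p p"
  by (simp add: scong_def)

lemma scong_mono: "scong V a k p q \<Longrightarrow> b \<le> a \<Longrightarrow> l \<le> k \<Longrightarrow> scong V b l p q"
  by (auto simp: scong_def intro: mps_ord_mono)

lemma scong_add: "scong V a k p q \<Longrightarrow> scong V a k p' q' \<Longrightarrow> scong V a k (p + p') (q + q')"
  by (auto simp: scong_def mps_ord_add add_diff_add)

lemma scong_diff: "scong V a k p q \<Longrightarrow> scong V a k p' q' \<Longrightarrow> scong V a k (p - p') (q - q')"
  unfolding scong_def using mps_ord_diff[of "p - q" V k "p' - q'"]
  by (auto simp: mps_ord_diff algebra_simps)

lemma scong_const_mult: "scong V a k p q \<Longrightarrow> scong V a k (mps_const c * p) (mps_const c * q)"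
  by (auto simp: scong_def mps_ord_const_mult simp flip: right_diff_distrib)

lemma scong_sum:
  "(\<And>x. x \<in> A \<Longrightarrow> scong V a k (p x) (q x)) \<Longrightarrow> scong V a k (sum p A) (sum q A)"
  by (auto simp: scong_def mps_ord_sum simp flip: sum_subtractf)

lemma scong_mult:
  assumes "scong V a k p q" "scong V b l p' q'" "m \<le> k + b" "m \<le> a + l"
  shows "scong V (a + b) m (p * p') (q * q')"
proof -
  have "p * p' - q * q' = (p - q) * p' + q * (p' - q')"
    by (simp add: algebra_simps)
  moreover have "(p - q) * p' \<in> mps_ord V m" "q * (p' - q') \<in> mps_ord V m"
    using assms mps_ord_mult[of "p - q" V k p' b] mps_ord_mult[of q V a "p' - q'" l]
    by (auto simp: scong_def intro: mps_ord_mono)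
  ultimately show ?thesis
    using assms by (auto simp: scong_def mps_ord_mult mps_ord_add)
qed

lemma scong_deriv: "scong V (Suc a) (Suc k) p q \<Longrightarrow> scong V a k (mps_deriv v p) (mps_deriv v q)"
  by (auto simp: scong_def mps_ord_deriv simp flip: mps_deriv_diff)

lemma scong_subst:
  assumes V: "finite V" and p: "scong V a k p q"
    and F: "\<And>v. v \<in> V \<Longrightarrow> scong V 1 (Suc l) (F v) (G v)" and "k \<le> a + l"
  shows "scong V a k (mps_subst F p) (mps_subst G q)"
proof -
  have F': "F v \<in> mps_ord V 1 \<and> G v \<in> mps_ord V 1 \<and> F v - G v \<in> mps_ord V (Suc l)" if "v \<in> V" for v
    using F[OF that] by (simp add: scong_def)
  then have G': "G v \<in> mps_ord V 1 \<and> G v \<in> mps_ord V 1 \<and> G v - G v \<in> mps_ord V (Suc l)" if "v \<in> V" for v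
    using that by simp
  have pq: "p \<in> mps_ord V a" "q \<in> mps_ord V a" "p - q \<in> mps_ord V k" "p \<in> mps_in V" "q \<in> mps_in V"
    using p mps_ord_mono by (auto simp: scong_def mps_in_eq_ord)
  have "mps_subst F p - mps_subst G q = mps_subst F (p - q) + (mps_subst F q - mps_subst G q)"
    using mps_subst_diff[OF V pq(4,5), of F] F' by simp
  moreover have "mps_subst F (p - q) \<in> mps_ord V k"
    using mps_subst_ord(1)[OF V pq(3) F'] .
  moreover have "mps_subst F q - mps_subst G q \<in> mps_ord V k"
    using mps_subst_ord(2)[where F = F and G = G, OF V pq(2) F'] \<open>k \<le> a + l\<close> mps_ord_mono by blast
  ultimately have "mps_subst F p - mps_subst G q \<in> mps_ord V k"
    by (metis mps_ord_add)
  then show ?thesis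
    using mps_subst_ord(1)[where F = F, OF V pq(1) F'] mps_subst_ord(1)[where F = G, OF V pq(2) G']
    unfolding scong_def by blast
qed

text \<open>A substitution tangent to the identity changes a series only in higher degree, so the
  congruence gains one degree.\<close>

lemma scong_diff_subst:
  assumes V: "finite V" and p: "scong V a k p q" and k: "k < a + l"
    and F: "\<And>v. v \<in> V \<Longrightarrow> scong V 1 (Suc l) (F v) (G v) \<and>
      F v - mps_var v \<in> mps_ord V 2 \<and> G v - mps_var v \<in> mps_ord V 2"
  shows "scong V a (Suc k) (p - mps_subst F p) (q - mps_subst G q)"
proof -
  have FG: "F v \<in> mps_ord V 1 \<and> G v \<in> mps_ord V 1 \<and> F v - G v \<in> mps_ord V (Suc l)"
    and FI: "F v \<in> mps_ord V 1 \<and> mps_var v \<in> mps_ord V 1 \<and> F v - mps_var v \<in> mps_ord V (Suc 1)"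
    if "v \<in> V" for v
    using F[OF that] that mps_var_ord[of v V] by (auto simp: scong_def numeral_2_eq_2)
  have pq: "p \<in> mps_ord V a" "q \<in> mps_ord V a" "p - q \<in> mps_ord V k" "p \<in> mps_in V" "q \<in> mps_in V"
    "p - q \<in> mps_in V"
    using p mps_ord_mono by (auto simp: scong_def mps_in_eq_ord)
  \<comment> \<open>Substituting \<open>mps_var\<close> is the identity, so the difference splits
    into \<open>F\<close> against the identity on \<open>p - q\<close>, which gains one degree over
    \<open>k\<close> by tangency, and \<open>F\<close> against \<open>G\<close> on \<open>q\<close>,
    of order \<open>a + l > k\<close>.\<close>
  have "p - mps_subst F p - (q - mps_subst G q)
      = - ((mps_subst F (p - q) - mps_subst mps_var (p - q)) + (mps_subst F q - mps_subst G q))"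
    using mps_subst_diff[OF V pq(4,5), of F] FG mps_subst_var[OF V pq(6)]
    by (simp add: algebra_simps)
  moreover have "mps_subst F (p - q) - mps_subst mps_var (p - q) \<in> mps_ord V (Suc k)"
    using mps_subst_ord(2)[OF V pq(3) FI] by simp
  moreover have "mps_subst F q - mps_subst G q \<in> mps_ord V (Suc k)"
    using mps_subst_ord(2)[where F = F and G = G, OF V pq(2) FG] k by (auto intro: mps_ord_mono)
  ultimately have "p - mps_subst F p - (q - mps_subst G q) \<in> mps_ord V (Suc k)"
    by (metis mps_ord_add mps_ord_uminus)
  moreover have "scong V a k (mps_subst F p) (mps_subst G q)"
    using F k p by (intro scong_subst[OF V]) auto
  ultimately show ?thesis
    using pq unfolding scong_def by (blast intro: mps_ord_diff)
qed

lemma scong_0: "p \<in> mps_ord V a \<Longrightarrow> q \<in> mps_ord V a \<Longrightarrow> scong V a 0 p q"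
  unfolding scong_def by (meson mps_ord_diff mps_ord_mono zero_le)

lemma scong_coeff: "scong V a k p q \<Longrightarrow> size m < k \<Longrightarrow> mps_coeff p m = mps_coeff q m"
  unfolding scong_def mps_ord_def by force

lemma scongI:
  "p \<in> mps_ord V a \<Longrightarrow> q \<in> mps_ord V a \<Longrightarrow> (\<And>m. size m < k \<Longrightarrow> mps_coeff p m = mps_coeff q m)
    \<Longrightarrow> scong V a k p q"
  unfolding scong_def mps_ord_def
  by simp (metis diff_self linorder_not_le)

section \<open>Congruence of matrices and vectors, and completeness\<close>

definition mcong :: "'v set \<Rightarrow> nat \<Rightarrow> nat \<Rightarrow> nat \<Rightarrow> nat \<Rightarrow>
    ('v, 'a :: comm_ring_1) mps mat \<Rightarrow> ('v, 'a) mps mat \<Rightarrow> bool" where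
  "mcong V a k r c A B \<longleftrightarrow> A \<in> carrier_mat r c \<and> B \<in> carrier_mat r c \<and>
    (\<forall>i<r. \<forall>j<c. scong V a k (A $$ (i, j)) (B $$ (i, j)))"

definition vcong :: "'v set \<Rightarrow> nat \<Rightarrow> nat \<Rightarrow> nat \<Rightarrow>
    ('v, 'a :: comm_ring_1) mps vec \<Rightarrow> ('v, 'a) mps vec \<Rightarrow> bool" where
  "vcong V a k r v w \<longleftrightarrow> v \<in> carrier_vec r \<and> w \<in> carrier_vec r \<and>
    (\<forall>i<r. scong V a k (v $ i) (w $ i))"

lemma mcong_mono: "mcong V a k r c A B \<Longrightarrow> b \<le> a \<Longrightarrow> l \<le> k \<Longrightarrow> mcong V b l r c A B"
  by (auto simp: mcong_def intro: scong_mono)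

lemma mcong_carrier: "mcong V a k r c A B \<Longrightarrow> A \<in> carrier_mat r c"
  and mcong_carrier': "mcong V a k r c A B \<Longrightarrow> B \<in> carrier_mat r c"
  by (auto simp: mcong_def)

text \<open>On the diagonal the relation becomes a typing statement: an \<open>r\<close> by
  \<open>c\<close> matrix whose entries have order at least \<open>a\<close>. The spaces in which
  fixed points are sought are expressed in this way.\<close>

lemma mcong_refl: "mcong V a k r c A B \<Longrightarrow> mcong V a l r c A A"
  by (simp add: mcong_def scong_def)

lemma mcong_add: "mcong V a k r c A B \<Longrightarrow> mcong V a k r c A' B' \<Longrightarrow> mcong V a k r c (A + A') (B + B')"
  by (auto simp: mcong_def scong_add)

lemma mcong_diff: "mcong V a k r c A B \<Longrightarrow> mcong V a k r c A' B' \<Longrightarrow> mcong V a k r c (A - A') (B - B')"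
  by (auto simp: mcong_def scong_diff)

lemma mcong_smult: "mcong V a k r c A B \<Longrightarrow> mcong V a k r c (mps_const x \<cdot>\<^sub>m A) (mps_const x \<cdot>\<^sub>m B)"
  by (auto simp: mcong_def scong_const_mult)

lemma mcong_mult:
  assumes "mcong V a k r c A B" "mcong V b l c s A' B'" "m \<le> k + b" "m \<le> a + l"
  shows "mcong V (a + b) m r s (A * A') (B * B')"
  using assms unfolding mcong_def
  by (auto simp: scalar_prod_def intro!: scong_sum scong_mult[where k = k and l = l])

lemma mcong_one: "mcong V 0 k r r (1\<^sub>m r) (1\<^sub>m r)"
  by (auto simp: mcong_def intro: scong_refl)

lemma scong_sym: "scong V a k p q \<Longrightarrow> scong V a k q p"
  using mps_ord_uminus[of "p - q" V k] by (simp add: scong_def)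

lemma scong_trans: "scong V a k p q \<Longrightarrow> scong V a k q r \<Longrightarrow> scong V a k p r"
  using mps_ord_add[of "p - q" V k "q - r"] by (simp add: scong_def)

lemma mcong_sym: "mcong V a k r c A B \<Longrightarrow> mcong V a k r c B A"
  unfolding mcong_def by (blast intro: scong_sym)

lemma mcong_trans: "mcong V a k r c A B \<Longrightarrow> mcong V a k r c B C \<Longrightarrow> mcong V a k r c A C"
  unfolding mcong_def by (blast intro: scong_trans)

lemma mcong_0: "mcong V a k r c A A \<Longrightarrow> mcong V a l r c B B \<Longrightarrow> mcong V a 0 r c A B"
  unfolding mcong_def by (simp add: scong_def[of V a k] scong_def[of V a l] scong_0)

lemma mcong_eq:
  assumes "\<And>k. mcong V a k r c A B"
  shows "A = B"
proof (rule eq_matI)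
  show "dim_row A = dim_row B" "dim_col A = dim_col B"
    using assms[of 0] by (auto simp: mcong_def)
  show "A $$ (i, j) = B $$ (i, j)" if "i < dim_row B" "j < dim_col B" for i j
  proof (rule mps_eqI)
    show "mps_coeff (A $$ (i, j)) m = mps_coeff (B $$ (i, j)) m" for m
      using assms[of "Suc (size m)"] that
      by (intro scong_coeff[of V a "Suc (size m)"]) (auto simp: mcong_def)
  qed
qed

lemma scong_complete:
  assumes "\<And>k. scong V a k (x k) (x (Suc k))"
  shows "scong V a k (x k) (Abs_mps (\<lambda>m. mps_coeff (x (Suc (size m))) m))"
proof -
  have x: "x k \<in> mps_ord V a" for k
    using assms by (auto simp: scong_def)
  have stable: "mps_coeff (x k) m = mps_coeff (x (Suc (size m))) m" if "size m < k" for k m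
  proof -
    from that have "Suc (size m) \<le> k"
      by simp
    then show ?thesis
    proof (induction k rule: dec_induct)
      case (step k)
      then show ?case
        using scong_coeff[OF assms, of m k] by simp
    qed simp
  qed
  have "Abs_mps (\<lambda>m. mps_coeff (x (Suc (size m))) m) \<in> mps_ord V a"
    unfolding mps_ord_def mem_Collect_eq mps_coeff_Abs using mps_ordD[OF x] by blast
  with x show ?thesis
    by (rule scongI) (subst mps_coeff_Abs, rule stable)
qed

lemma mcong_complete:
  assumes "\<And>k. mcong V a k r c (X k) (X (Suc k))"
  obtains A where "\<And>k. mcong V a k r c (X k) A"
proof
  let ?A = "mat r c (\<lambda>(i, j). Abs_mps (\<lambda>m. mps_coeff (X (Suc (size m)) $$ (i, j)) m))"
  show "mcong V a k r c (X k) ?A" for k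
  proof -
    have "scong V a k (X k $$ (i, j)) (?A $$ (i, j))" if "i < r" "j < c" for i j
      using scong_complete[of V a "\<lambda>k. X k $$ (i, j)"] assms that by (simp add: mcong_def)
    then show ?thesis
      using assms[of k] by (simp add: mcong_def)
  qed
qed


section \<open>Fixed points of degree-raising maps\<close>

text \<open>The contraction principle with a filtration in place of a metric, \<open>E k\<close>
  being read as agreement below degree \<open>k\<close>. Iterates agree to ever higher degree and
  hence converge; two fixed points agree to every degree and hence coincide.\<close>

lemma filtered_fixpoint:
  fixes E :: "nat \<Rightarrow> 'x \<Rightarrow> 'x \<Rightarrow> bool" and S :: "'x set"
  assumes E0: "\<And>x y. x \<in> S \<Longrightarrow> y \<in> S \<Longrightarrow> E 0 x y"
    and trans: "\<And>k x y z. E k x y \<Longrightarrow> E k y z \<Longrightarrow> E k x z"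
    and sym: "\<And>k x y. E k x y \<Longrightarrow> E k y x"
    and separated: "\<And>x y. x \<in> S \<Longrightarrow> y \<in> S \<Longrightarrow> (\<And>k. E k x y) \<Longrightarrow> x = y"
    and complete: "\<And>X. (\<And>k. X k \<in> S) \<Longrightarrow> (\<And>k. E k (X k) (X (Suc k))) \<Longrightarrow> \<exists>x\<in>S. \<forall>k. E k (X k) x"
    and "x0 \<in> S" and closed: "\<And>x. x \<in> S \<Longrightarrow> \<Psi> x \<in> S"
    and contraction: "\<And>k x y. x \<in> S \<Longrightarrow> y \<in> S \<Longrightarrow> E k x y \<Longrightarrow> E (Suc k) (\<Psi> x) (\<Psi> y)"
  shows "\<exists>!x. x \<in> S \<and> \<Psi> x = x"
proof -
  define X where "X k = (\<Psi> ^^ k) x0" for k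
  have X_Suc: "X (Suc k) = \<Psi> (X k)" for k
    by (simp add: X_def)
  have X: "X k \<in> S" for k
    by (induction k) (use \<open>x0 \<in> S\<close> closed in \<open>auto simp: X_def\<close>)
  have "E k (X k) (X (Suc k))" for k
  proof (induction k)
    case (Suc k)
    then show ?case
      using contraction[OF X X Suc] by (simp only: X_Suc)
  qed (use E0 X in auto)
  then obtain x where x: "x \<in> S" "\<And>k. E k (X k) x"
    using complete X by meson
  have "E k (\<Psi> x) x" for k
  proof (cases k)
    case (Suc l)
    have "E (Suc l) (X (Suc l)) (\<Psi> x)"
      using contraction[OF X x(1) x(2)[of l]] by (simp only: X_Suc)
    then show ?thesis
      using trans[OF sym x(2)] Suc by simp
  qed (use E0 x closed in auto)
  then have fp: "\<Psi> x = x"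
    using separated closed x(1) by blast
  have "y = x" if y: "y \<in> S" "\<Psi> y = y" for y
  proof (rule separated[OF y(1) x(1)])
    show "E k y x" for k
    proof (induction k)
      case (Suc k)
      then show ?case
        using contraction[OF y(1) x(1) Suc] by (simp only: y(2) fp)
    qed (use E0 x y in auto)
  qed
  with x(1) fp show ?thesis
    by blast
qed

text \<open>Invariance of the space under \<open>\<Psi>\<close> is the contraction hypothesis at
  \<open>k = 0\<close> and \<open>Y = X\<close>. The two components serve the pair (P, Q) in the
  main argument, and the right and left inverse in the inversion of \<open>1 - A\<close>.\<close>

lemma mat_pair_fixpoint:
  fixes V :: "'v set" and a r c r' c' :: nat and \<Psi> :: "('v, 'a :: comm_ring_1) mps mat \<times> ('v, 'a) mps mat \<Rightarrow> ('v, 'a) mps mat \<times> ('v, 'a) mps mat"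
  defines "E \<equiv> \<lambda>k X Y. mcong V a k r c (fst X) (fst Y) \<and> mcong V a k r' c' (snd X) (snd Y)"
  assumes contraction: "\<And>k X Y. E k X Y \<Longrightarrow> E (Suc k) (\<Psi> X) (\<Psi> Y)"
  shows "\<exists>!X. E 0 X X \<and> \<Psi> X = X"
proof -
  have "\<exists>!X. X \<in> {X. E 0 X X} \<and> \<Psi> X = X"
  proof (rule filtered_fixpoint[where E = E and ?x0.0 = "(0\<^sub>m r c, 0\<^sub>m r' c')"])
    show "E 0 X Y" if "X \<in> {X. E 0 X X}" "Y \<in> {X. E 0 X X}" for X Y
      using that mcong_0 unfolding E_def by blast
    show "E k X Z" if "E k X Y" "E k Y Z" for k X Y Z
      using that mcong_trans[of V a k _ _ "fst X" "fst Y" "fst Z"]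
        mcong_trans[of V a k _ _ "snd X" "snd Y" "snd Z"] unfolding E_def by blast
    show "E k Y X" if "E k X Y" for k X Y
      using that mcong_sym unfolding E_def by blast
    show "X = Y" if "\<And>k. E k X Y" for X Y
      using that by (auto simp: E_def prod_eq_iff intro!: mcong_eq)
    show "\<exists>Y\<in>{X. E 0 X X}. \<forall>k. E k (X k) Y" if step: "\<And>k. E k (X k) (X (Suc k))" for X
    proof -
      obtain A where "\<And>k. mcong V a k r c (fst (X k)) A"
        using step mcong_complete[of V a r c "\<lambda>k. fst (X k)"] unfolding E_def by auto
      moreover obtain B where "\<And>k. mcong V a k r' c' (snd (X k)) B"
        using step mcong_complete[of V a r' c' "\<lambda>k. snd (X k)"] unfolding E_def by auto
      ultimately show ?thesis
        using mcong_refl[OF mcong_sym, of V a 0 r c "fst (X 0)" A 0]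
          mcong_refl[OF mcong_sym, of V a 0 r' c' "snd (X 0)" B 0]
        by (intro bexI[of _ "(A, B)"]) (auto simp: E_def)
    qed
    show "(0\<^sub>m r c, 0\<^sub>m r' c') \<in> {X. E 0 X X}"
      by (auto simp: E_def mcong_def intro: scong_refl)
    show "\<Psi> X \<in> {X. E 0 X X}" if "X \<in> {X. E 0 X X}" for X
      using contraction[of 0 X X] that mcong_mono[of V a "Suc 0" _ _ _ _ a 0] unfolding E_def by blast
    show "E (Suc k) (\<Psi> X) (\<Psi> Y)" if "E k X Y" for k X Y
      using that by (rule contraction)
  qed
  then show ?thesis
    by simp
qed

section \<open>Inversion of the identity minus a matrix of positive order\<close>

lemma mat_inv_eqI:
  assumes "A \<in> carrier_mat d d" "B \<in> carrier_mat d d" "A * B = 1\<^sub>m d" "B * A = 1\<^sub>m d"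
  shows "mat_inv A = B"
  unfolding mat_inv_def
proof (rule the_equality)
  show "B \<in> carrier_mat (dim_col A) (dim_row A) \<and> inverts_mat A B \<and> inverts_mat B A"
    using assms by (auto simp: inverts_mat_def)
  fix C assume C: "C \<in> carrier_mat (dim_col A) (dim_row A) \<and> inverts_mat A C \<and> inverts_mat C A"
  then have Cc: "C \<in> carrier_mat d d" and AC: "A * C = 1\<^sub>m d"
    using assms by (auto simp: inverts_mat_def)
  have "C = (B * A) * C"
    using Cc assms(4) by simp
  also have "\<dots> = B * (A * C)"
    by (rule assoc_mult_mat[OF assms(2,1) Cc])
  finally show "C = B"
    using AC assms(2) by simp
qed

text \<open>The geometric series as a fixed point: as \<open>A\<close> has order 1, both
  \<open>B \<mapsto> 1 + A * B\<close> and \<open>C \<mapsto> 1 + C * A\<close> gain a degree. Their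
  fixed points are a right and a left inverse of \<open>1 - A\<close>, which associativity
  identifies.\<close>

lemma mat_inv_one_minus:
  fixes A :: "('v, 'a :: comm_ring_1) mps mat"
  assumes A: "mcong V 1 k d d A A"
  defines "B \<equiv> mat_inv (1\<^sub>m d - A)"
  shows "mcong V 0 l d d B B" "B = 1\<^sub>m d + A * B" "B = 1\<^sub>m d + B * A"
proof -
  let ?\<Psi> = "\<lambda>(B, C). (1\<^sub>m d + A * B, 1\<^sub>m d + C * A)"
  have Ac: "A \<in> carrier_mat d d"
    using A by (rule mcong_carrier)
  have "\<exists>!X. (mcong V 0 0 d d (fst X) (fst X) \<and> mcong V 0 0 d d (snd X) (snd X)) \<and> ?\<Psi> X = X"
  proof (rule mat_pair_fixpoint)
    fix k and X Y :: "('v, 'a) mps mat \<times> ('v, 'a) mps mat"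
    assume "mcong V 0 k d d (fst X) (fst Y) \<and> mcong V 0 k d d (snd X) (snd Y)"
    then have X: "mcong V 0 k d d (fst X) (fst Y)" "mcong V 0 k d d (snd X) (snd Y)"
      by auto
    have "mcong V (1 + 0) (Suc k) d d (A * fst X) (A * fst Y)"
      "mcong V (0 + 1) (Suc k) d d (snd X * A) (snd Y * A)"
      by (rule mcong_mult[OF mcong_refl[OF A, of "Suc k"] X(1)]
        mcong_mult[OF X(2) mcong_refl[OF A, of "Suc k"]]; simp)+
    from mcong_mono[OF this(1)] mcong_mono[OF this(2)]
    show "mcong V 0 (Suc k) d d (fst (?\<Psi> X)) (fst (?\<Psi> Y)) \<and>
        mcong V 0 (Suc k) d d (snd (?\<Psi> X)) (snd (?\<Psi> Y))"
      by (simp add: case_prod_beta mcong_add mcong_one)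
  qed
  then obtain X where X: "mcong V 0 0 d d (fst X) (fst X)" "mcong V 0 0 d d (snd X) (snd X)"
    "?\<Psi> X = X"
    by (elim ex1E conjE) (rule that)
  obtain C D where "X = (C, D)"
    by (cases X)
  with X have C: "mcong V 0 0 d d C C" "1\<^sub>m d + A * C = C"
    and D: "mcong V 0 0 d d D D" "1\<^sub>m d + D * A = D"
    by simp_all
  note Cc = mcong_carrier[OF C(1)] and Dc = mcong_carrier[OF D(1)]
  have eq: "Y - Z = X" if "Y = X + Z" "X \<in> carrier_mat d d" "Z \<in> carrier_mat d d" for X Y Z :: "('v, 'a) mps mat"
    unfolding that(1) using that(2,3) by (intro eq_matI) auto
  have AC: "(1\<^sub>m d - A) * C = 1\<^sub>m d"
  proof -
    have "(1\<^sub>m d - A) * C = C - A * C"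
      using Ac Cc minus_mult_distrib_mat[of "1\<^sub>m d" d d A C d] by simp
    also have "\<dots> = 1\<^sub>m d"
      using C(2) Ac Cc by (intro eq) simp_all
    finally show ?thesis .
  qed
  have Mc: "1\<^sub>m d - A \<in> carrier_mat d d"
    by (rule minus_carrier_mat[OF Ac])
  have DA: "D * (1\<^sub>m d - A) = 1\<^sub>m d"
  proof -
    have "D * (1\<^sub>m d - A) = D - D * A"
      using Ac Dc mult_minus_distrib_mat[of D d d "1\<^sub>m d" d A] by simp
    also have "\<dots> = 1\<^sub>m d"
      using D(2) Ac Dc by (intro eq) simp_all
    finally show ?thesis .
  qed
  have "D = D * ((1\<^sub>m d - A) * C)"
    using Dc by (simp add: AC)
  also have "\<dots> = (D * (1\<^sub>m d - A)) * C"
    by (rule assoc_mult_mat[OF Dc Mc Cc, symmetric])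
  also have "\<dots> = C"
    using Cc by (simp add: DA)
  finally have "D = C" .
  then have "B = C"
    unfolding B_def using AC DA by (intro mat_inv_eqI[OF Mc Cc]) simp_all
  then show "mcong V 0 l d d B B" "B = 1\<^sub>m d + A * B" "B = 1\<^sub>m d + B * A"
    using mcong_refl[OF C(1), of l] C(2) D(2) unfolding \<open>D = C\<close> \<open>B = C\<close> by simp_all
qed

text \<open>By the resolvent identity \<open>B - B' = B * (A - A') * B'\<close>, the inverses agree
  as far as \<open>A\<close> and \<open>A'\<close> do.\<close>

lemma mcong_mat_inv_one_minus:
  fixes A :: "('v, 'a :: comm_ring_1) mps mat"
  assumes A: "mcong V 1 k d d A A'"
  shows "mcong V 0 k d d (mat_inv (1\<^sub>m d - A)) (mat_inv (1\<^sub>m d - A'))"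
proof -
  define B B' where "B = mat_inv (1\<^sub>m d - A)" and "B' = mat_inv (1\<^sub>m d - A')"
  note B = mat_inv_one_minus[OF mcong_refl[OF A], folded B_def]
  note B' = mat_inv_one_minus[OF mcong_refl[OF mcong_sym[OF A]], folded B'_def]
  have c: "A \<in> carrier_mat d d" "A' \<in> carrier_mat d d" "B \<in> carrier_mat d d" "B' \<in> carrier_mat d d"
    using A B(1)[of 0] B'(1)[of 0] by (simp_all add: mcong_def)
  have "mcong V (1 + 0) k d d (A * B') (A' * B')"
    using A B'(1)[of k] by (rule mcong_mult) auto
  then have "mcong V (0 + (1 + 0)) k d d (B * (A * B')) (B * (A' * B'))"
    by (rule mcong_mult[OF B(1)[of k]]) auto
  \<comment> \<open>The resolvent identity in a form free of subtraction: both sides equal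
    \<open>B * B'\<close>.\<close>
  moreover have "B' + B * (A * B') = B + B * (A' * B')"
  proof -
    have "B' + B * (A * B') = (1\<^sub>m d + B * A) * B'"
      using c by (simp add: add_mult_distrib_mat[of _ d d] assoc_mult_mat[of _ d d _ d _ d])
    also have "\<dots> = B * (1\<^sub>m d + A' * B')"
      by (simp only: B(3)[symmetric] B'(2)[symmetric])
    also have "\<dots> = B + B * (A' * B')"
      using c by (simp add: mult_add_distrib_mat[of B d d "1\<^sub>m d" d])
    finally show ?thesis .
  qed
  ultimately have "scong V 0 k (B $$ (i, j)) (B' $$ (i, j))" if "i < d" "j < d" for i j
  proof -
    let ?X = "B * (A * B')" and ?Y = "B * (A' * B')"
    assume X: "mcong V (0 + (1 + 0)) k d d ?X ?Y" and eq: "B' + ?X = B + ?Y"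
    have diff_eq: "p - q = x - y" if "q + x = p + y" for p q x y :: "('v, 'a) mps"
      using that by (metis add_diff_cancel_left diff_add_cancel add_diff_eq add_diff_cancel_right add.commute)
    have "(B' + ?X) $$ (i, j) = (B + ?Y) $$ (i, j)"
      by (simp only: eq)
    moreover have "i < dim_row ?X" "j < dim_col ?X" "i < dim_row ?Y" "j < dim_col ?Y"
      using that c by simp_all
    ultimately have "B $$ (i, j) - B' $$ (i, j) = ?X $$ (i, j) - ?Y $$ (i, j)"
      by (intro diff_eq) (simp only: index_add_mat)
    with X that B(1)[of 0] B'(1)[of 0] show ?thesis
      by (auto simp: mcong_def scong_def simp del: index_mult_mat(1))
  qed
  with c show ?thesis
    by (simp add: mcong_def B_def B'_def)
qed

section \<open>Conjugation, Jacobians and the induced structure\<close>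

lemma conj_var_conj_var [simp]: "conj_var (conj_var v) = v"
  by (cases v) auto

lemma image_mset_conj_var_conj_var [simp]: "image_mset conj_var (image_mset conj_var m) = m"
  by (simp add: multiset.map_comp comp_def)

lemma cr_conj_cr_conj [simp]: "cr_conj (cr_conj p) = p"
  by (rule mps_eqI) simp

lemma cr_conj_diff: "cr_conj (p - q) = cr_conj p - cr_conj q"
  by (rule mps_eqI) simp

lemma cr_conj_const_mult: "cr_conj (mps_const c * p) = mps_const (cnj c) * cr_conj p"
  by (rule mps_eqI) simp

lemma conj_var_cr_vars: "conj_var v \<in> cr_vars n d \<longleftrightarrow> v \<in> cr_vars n d"
  by (cases v) (auto simp: cr_vars_def z_vars_def zbar_vars_def u_vars_def)

lemma finite_cr_vars: "finite (cr_vars n d)"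
  by (simp add: cr_vars_def z_vars_def zbar_vars_def u_vars_def)

lemma conj_monomial_cr_vars:
  "set_mset (image_mset conj_var m) \<subseteq> cr_vars n d \<longleftrightarrow> set_mset m \<subseteq> cr_vars n d"
  using conj_var_cr_vars by auto

lemma cr_conj_ord: "p \<in> mps_ord (cr_vars n d) k \<Longrightarrow> cr_conj p \<in> mps_ord (cr_vars n d) k"
proof (rule mps_ordI)
  fix m assume "p \<in> mps_ord (cr_vars n d) k" "mps_coeff (cr_conj p) m \<noteq> 0"
  then have "set_mset (image_mset conj_var m) \<subseteq> cr_vars n d \<and> k \<le> size (image_mset conj_var m)"
    by (intro mps_ordD) auto
  then show "set_mset m \<subseteq> cr_vars n d \<and> k \<le> size m"
    by (simp only: conj_monomial_cr_vars size_image_mset)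
qed

lemma scong_conj:
  "scong (cr_vars n d) a k p q \<Longrightarrow> scong (cr_vars n d) a k (cr_conj p) (cr_conj q)"
  unfolding scong_def cr_conj_diff[symmetric] by (blast intro: cr_conj_ord)

lemma vcong_conj:
  "vcong (cr_vars n d) a k r v w \<Longrightarrow> vcong (cr_vars n d) a k r (map_vec cr_conj v) (map_vec cr_conj w)"
  by (auto simp: vcong_def scong_conj)

text \<open>Differentiation costs one degree, both of order and of agreement; this is the loss that
  the later estimates have to recover.\<close>

lemma mcong_jac:
  assumes "vcong V (Suc a) (Suc k) r f f'"
  shows "mcong V a k r c (jac_z c f) (jac_z c f')" "mcong V a k r c (jac_zbar c f) (jac_zbar c f')"
    "mcong V a k r c (jac_u c f) (jac_u c f')"
  using assms by (auto simp: mcong_def vcong_def jac_z_def jac_zbar_def jac_u_def scong_deriv)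

lemma mcong_refl_iff: "mcong V a k r c A A \<longleftrightarrow>
    A \<in> carrier_mat r c \<and> (\<forall>i<r. \<forall>j<c. A $$ (i, j) \<in> mps_ord V a)"
  by (simp add: mcong_def scong_def)

lemma vcong_refl_iff: "vcong V a k r v v \<longleftrightarrow> v \<in> carrier_vec r \<and> (\<forall>i<r. v $ i \<in> mps_ord V a)"
  by (simp add: vcong_def scong_def)

lemma mcong_1_iff: "mcong V 1 k r c A A \<longleftrightarrow> A \<in> mat_series r c V \<and> mat_no_constant_term A"
proof (cases "A \<in> carrier_mat r c")
  case True
  then have "dim_row A = r" "dim_col A = c"
    by auto
  with True show ?thesis
    unfolding mcong_refl_iff mps_ord_1_iff mat_series_def mat_no_constant_term_def by blast
qed (simp add: mcong_refl_iff mat_series_def)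

lemma vcong_2_iff: "vcong V 2 k r v v \<longleftrightarrow> v \<in> vec_series r V \<and> vec_no_constant_linear_terms v"
proof (cases "v \<in> carrier_vec r")
  case True
  then have "dim_vec v = r"
    by auto
  with True show ?thesis
    unfolding vcong_refl_iff mps_ord_2_iff vec_series_def vec_no_constant_linear_terms_def by blast
qed (simp add: vcong_refl_iff vec_series_def)

lemma vec_series_mono: "v \<in> vec_series r V \<Longrightarrow> V \<subseteq> W \<Longrightarrow> v \<in> vec_series r W"
  unfolding vec_series_def mps_in_def by blast

text \<open>The inverse equals \<open>1 + A * mat_inv (1 - A)\<close>, which splits off the part i
  \<phi>_z linear in \<phi>; the remainder contains the factor i \<phi>_u besides \<phi>_z.\<close>

lemma induced_w_eq:
  fixes \<phi> :: "cr_series vec"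
  assumes "vcong V 2 k d \<phi> \<phi>"
  defines "A \<equiv> mps_const \<i> \<cdot>\<^sub>m jac_u d \<phi>"
  shows "induced_w n d \<phi> = mps_const \<i> \<cdot>\<^sub>m (jac_z n \<phi> + A * (mat_inv (1\<^sub>m d - A) * jac_z n \<phi>))"
proof -
  have \<phi>: "vcong V (Suc 1) (Suc 1) d \<phi> \<phi>"
    using assms(1) by (simp add: vcong_refl_iff numeral_2_eq_2)
  have A: "mcong V 1 1 d d A A"
    unfolding A_def by (intro mcong_smult mcong_jac[OF \<phi>])
  have J: "jac_z n \<phi> \<in> carrier_mat d n"
    by (rule mcong_carrier[OF mcong_jac(1)[OF \<phi>]])
  define B where "B = mat_inv (1\<^sub>m d - A)"
  note B = mat_inv_one_minus[OF A, folded B_def]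
  have c: "A \<in> carrier_mat d d" "B \<in> carrier_mat d d"
    using A B(1)[of 0] by (auto simp: mcong_def)
  have "B * jac_z n \<phi> = (1\<^sub>m d + A * B) * jac_z n \<phi>"
    by (simp only: B(2)[symmetric])
  also have "\<dots> = jac_z n \<phi> + A * (B * jac_z n \<phi>)"
    using c J by (simp add: add_mult_distrib_mat[of _ d d] assoc_mult_mat[of _ d d _ d _ n])
  finally show ?thesis
    by (simp only: induced_w_def A_def[symmetric] B_def[symmetric])
qed

text \<open>One derivative of \<phi> leaves agreement below degree \<open>k\<close>. Once i \<phi>_z
  is removed, what remains is a product containing two factors of order 1, each agreeing below
  degree \<open>k\<close>, and the lost degree comes back. The second form is the correction in
  \<open>step\<close>.\<close>

lemma mcong_induced_w:
  fixes \<phi> \<phi>' :: "cr_series vec"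
  assumes "vcong V 2 (Suc k) d \<phi> \<phi>'"
  shows "mcong V 1 k d n (induced_w n d \<phi>) (induced_w n d \<phi>')"
    and "mcong V 1 (Suc k) d n (mps_const \<i> \<cdot>\<^sub>m jac_z n \<phi> - induced_w n d \<phi>)
      (mps_const \<i> \<cdot>\<^sub>m jac_z n \<phi>' - induced_w n d \<phi>')"
proof -
  have \<phi>: "vcong V (Suc 1) (Suc k) d \<phi> \<phi>'"
    using assms by (simp add: numeral_2_eq_2)
  have r: "vcong V 2 k d \<phi> \<phi>" "vcong V 2 k d \<phi>' \<phi>'"
    using assms by (auto simp: vcong_def scong_def)
  define A A' where "A = mps_const \<i> \<cdot>\<^sub>m jac_u d \<phi>" and "A' = mps_const \<i> \<cdot>\<^sub>m jac_u d \<phi>'"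
  define C C' where "C = A * (mat_inv (1\<^sub>m d - A) * jac_z n \<phi>)"
    and "C' = A' * (mat_inv (1\<^sub>m d - A') * jac_z n \<phi>')"
  have A: "mcong V 1 k d d A A'"
    unfolding A_def A'_def by (intro mcong_smult mcong_jac[OF \<phi>])
  note J = mcong_jac(1)[OF \<phi>, of n]
  have "mcong V (0 + 1) k d n (mat_inv (1\<^sub>m d - A) * jac_z n \<phi>) (mat_inv (1\<^sub>m d - A') * jac_z n \<phi>')"
    by (rule mcong_mult[OF mcong_mat_inv_one_minus[OF A] J]) auto
  then have "mcong V (1 + (0 + 1)) (Suc k) d n C C'"
    unfolding C_def C'_def by (rule mcong_mult[OF A]) auto
  then have C: "mcong V 1 (Suc k) d n C C'"
    by (rule mcong_mono) auto
  have eq: "induced_w n d \<phi> = mps_const \<i> \<cdot>\<^sub>m (jac_z n \<phi> + C)"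
    "induced_w n d \<phi>' = mps_const \<i> \<cdot>\<^sub>m (jac_z n \<phi>' + C')"
    using r by (auto simp: induced_w_eq[of V k] A_def A'_def C_def C'_def)
  show "mcong V 1 k d n (induced_w n d \<phi>) (induced_w n d \<phi>')"
    unfolding eq by (intro mcong_smult mcong_add J mcong_mono[OF C]) auto
  have c: "C \<in> carrier_mat d n" "C' \<in> carrier_mat d n" "jac_z n \<phi> \<in> carrier_mat d n"
      "jac_z n \<phi>' \<in> carrier_mat d n"
    using C J by (auto simp: mcong_def)
  have diff: "mps_const \<i> \<cdot>\<^sub>m X - mps_const \<i> \<cdot>\<^sub>m (X + Y) = mps_const (- \<i>) \<cdot>\<^sub>m Y"
    if "X \<in> carrier_mat d n" "Y \<in> carrier_mat d n" for X Y :: "cr_series mat"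
    using that by (intro eq_matI mps_eqI) (auto simp: algebra_simps)
  show "mcong V 1 (Suc k) d n (mps_const \<i> \<cdot>\<^sub>m jac_z n \<phi> - induced_w n d \<phi>)
      (mps_const \<i> \<cdot>\<^sub>m jac_z n \<phi>' - induced_w n d \<phi>')"
    unfolding eq using c by (simp only: diff) (rule mcong_smult[OF C])
qed


section \<open>The Euler operator\<close>

definition zdeg :: "cr_var multiset \<Rightarrow> nat" where
  "zdeg m = size {#v \<in># m. v \<in> range Z#}"

lemma zdeg_eq_0_iff: "zdeg m = 0 \<longleftrightarrow> (\<forall>j. Z j \<notin># m)"
  unfolding zdeg_def size_eq_0_iff_empty filter_mset_eq_mempty_iff by auto

text \<open>Conjugation exchanges z and zbar, so \<open>zdeg\<close> of the conjugate monomial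
  counts the factors zbar; freeness from zbar is expressed through it from here on.\<close>

lemma zdeg_conj_eq_0_iff: "zdeg (image_mset conj_var m) = 0 \<longleftrightarrow> (\<forall>j. Zbar j \<notin># m)"
proof -
  have "Z j \<in># image_mset conj_var m \<longleftrightarrow> Zbar j \<in># m" for j
    by (metis conj_var.simps(2) conj_var_conj_var image_eqI image_iff set_image_mset)
  then show ?thesis
    by (simp only: zdeg_eq_0_iff)
qed

lemma zdeg_eq_sum: "set_mset m \<subseteq> cr_vars n d \<Longrightarrow> zdeg m = (\<Sum>j<n. count m (Z j))"
proof -
  assume m: "set_mset m \<subseteq> cr_vars n d"
  let ?M = "{#v \<in># m. v \<in> range Z#}"
  have "zdeg m = sum (count ?M) (set_mset ?M)"
    by (simp only: zdeg_def size_multiset_overloaded_eq)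
  also have "\<dots> = sum (count ?M) (Z ` {..<n})"
    using m by (intro sum.mono_neutral_left)
      (auto simp: cr_vars_def z_vars_def zbar_vars_def u_vars_def not_in_iff)
  also have "\<dots> = (\<Sum>j<n. count m (Z j))"
    by (subst sum.reindex) (auto simp: inj_on_def)
  finally show ?thesis .
qed

lemma mult_euler_index:
  "A \<in> carrier_mat r n \<Longrightarrow> i < r \<Longrightarrow> (A *\<^sub>v euler_field n) $ i = (\<Sum>j<n. mps_var (Z j) * A $$ (i, j))"
  by (auto simp: euler_field_def scalar_prod_def mult.commute lessThan_atLeast0 intro!: sum.cong)

text \<open>Euler's identity: z_j d/dz_j multiplies a monomial by its exponent of z_j. Membership in
  \<open>cr_vars n d\<close> ensures that the sum over \<open>j < n\<close> exhausts
  \<open>zdeg\<close>.\<close>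

lemma euler_jac_z_coeff:
  assumes "h \<in> carrier_vec r" "i < r" "h $ i \<in> mps_in (cr_vars n d)"
  shows "mps_coeff ((jac_z n h *\<^sub>v euler_field n) $ i) m = of_nat (zdeg m) * mps_coeff (h $ i) m"
proof -
  have J: "jac_z n h \<in> carrier_mat r n"
    using assms(1) by (auto simp: jac_z_def)
  have "mps_coeff ((jac_z n h *\<^sub>v euler_field n) $ i) m =
      (\<Sum>j<n. of_nat (count m (Z j)) * mps_coeff (h $ i) m)"
    unfolding mult_euler_index[OF J assms(2)] mps_coeff_sum
    using assms(1,2) by (intro sum.cong) (auto simp: jac_z_def simp flip: mps_coeff_var_mult_deriv)
  also have "\<dots> = of_nat (zdeg m) * mps_coeff (h $ i) m"
  proof (cases "mps_coeff (h $ i) m = 0")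
    case False
    then have "set_mset m \<subseteq> cr_vars n d"
      using assms(3) by (simp add: mps_in_def)
    then show ?thesis
      by (simp add: zdeg_eq_sum sum_distrib_right)
  qed simp
  finally show ?thesis .
qed

text \<open>Every summand carries a factor z_j. This is the solvability condition of the Euler
  equation, since e(h) has no term free of z either.\<close>

lemma mult_euler_coeff_zdeg_0:
  assumes "A \<in> carrier_mat r n" "i < r" "zdeg m = 0"
  shows "mps_coeff ((A *\<^sub>v euler_field n) $ i) m = 0"
  using assms by (simp add: mult_euler_index mps_coeff_var_mult zdeg_eq_0_iff del: index_mult_mat_vec)

text \<open>The factor z_j adds one degree. This is why (P, Q) known below degree k gives f, g,
  \<phi> below degree k + 1, so that one derivative of these only returns to k.\<close>

lemma scong_mult_euler:
  assumes "mcong (cr_vars n d) a k r n A A'" "i < r"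
  shows "scong (cr_vars n d) (Suc a) (Suc k) ((A *\<^sub>v euler_field n) $ i) ((A' *\<^sub>v euler_field n) $ i)"
proof -
  have "scong (cr_vars n d) (1 + a) (Suc k) (mps_var (Z j) * A $$ (i, j)) (mps_var (Z j) * A' $$ (i, j))"
    if "j < n" for j
    using assms that
    by (intro scong_mult[of _ 1 "Suc k" _ _ a k] scong_refl mps_var_ord)
      (auto simp: mcong_def cr_vars_def z_vars_def)
  then show ?thesis
    using assms(1) by (simp only: mult_euler_index[OF mcong_carrier[OF assms(1)] assms(2)]
        mult_euler_index[OF mcong_carrier'[OF assms(1)] assms(2)]) (auto intro!: scong_sum)
qed

text \<open>The solution of \<open>e(h) = - p\<close> whose part free of \<open>z\<close> is that of \<open>b\<close>, when \<open>p\<close> has no such part.\<close>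

definition euler_solve :: "cr_series \<Rightarrow> cr_series \<Rightarrow> cr_series" where
  "euler_solve b p = Abs_mps (\<lambda>m. if zdeg m = 0 then mps_coeff b m else - mps_coeff p m / of_nat (zdeg m))"

lemma euler_solve_coeff [simp]:
  "mps_coeff (euler_solve b p) m = (if zdeg m = 0 then mps_coeff b m else - mps_coeff p m / of_nat (zdeg m))"
  by (simp add: euler_solve_def)

lemma euler_solve_ord: "b \<in> mps_ord V k \<Longrightarrow> p \<in> mps_ord V k \<Longrightarrow> euler_solve b p \<in> mps_ord V k"
  by (auto simp: mps_ord_def split: if_splits)

text \<open>\<open>euler_solve\<close> is linear in its two arguments jointly and moves no
  coefficient between monomials, so nothing is lost.\<close>

lemma scong_euler_solve:
  assumes "scong V a k b b'" "scong V a k p p'"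
  shows "scong V a k (euler_solve b p) (euler_solve b' p')"
proof -
  have "euler_solve b p - euler_solve b' p' = euler_solve (b - b') (p - p')"
    by (rule mps_eqI) (simp add: diff_divide_distrib)
  then show ?thesis
    using assms by (simp add: scong_def euler_solve_ord)
qed


section \<open>Real and imaginary parts\<close>

definition re_part :: "cr_series \<Rightarrow> cr_series" where
  "re_part h = mps_const (1 / 2) * (h + cr_conj h)"

text \<open>The sign is chosen for \<open>h = g - \<i> \<phi>\<close>.\<close>

definition im_part :: "cr_series \<Rightarrow> cr_series" where
  "im_part h = mps_const (\<i> / 2) * (h - cr_conj h)"

lemma real_valued_re_part: "real_valued (re_part h)"
  and real_valued_im_part: "real_valued (im_part h)"
  unfolding real_valued_def re_part_def im_part_def
  by (simp_all add: mps_eq_iff, simp_all add: field_simps)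

lemma real_valued_coeff: "real_valued p \<Longrightarrow> cnj (mps_coeff p (image_mset conj_var m)) = mps_coeff p m"
  unfolding real_valued_def by (metis cr_conj.rep_eq)

lemma re_part_minus_im_part: "re_part h - mps_const \<i> * im_part h = h"
  by (rule mps_eqI) (simp add: re_part_def im_part_def, simp add: field_simps)

lemma re_im_part_eq:
  assumes "real_valued g" "real_valued \<phi>"
  shows "re_part (g - mps_const \<i> * \<phi>) = g" "im_part (g - mps_const \<i> * \<phi>) = \<phi>"
proof -
  have eq: "cr_conj (g - mps_const \<i> * \<phi>) = g + mps_const \<i> * \<phi>"
    using assms by (intro mps_eqI) (simp add: cr_conj_diff cr_conj_const_mult real_valued_def del: cr_conj.rep_eq)
  show "re_part (g - mps_const \<i> * \<phi>) = g" "im_part (g - mps_const \<i> * \<phi>) = \<phi>"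
    unfolding re_part_def im_part_def eq
    by (simp_all only: mps_eq_iff plus_mps.rep_eq minus_mps.rep_eq mps_coeff_const_mult)
      (simp_all add: field_simps)
qed

lemma scong_re_im_part:
  assumes "scong (cr_vars n d) a k p q"
  shows "scong (cr_vars n d) a k (re_part p) (re_part q)"
    and "scong (cr_vars n d) a k (im_part p) (im_part q)"
  unfolding re_part_def im_part_def
  by (intro scong_const_mult scong_add scong_diff scong_conj assms)+

lemma mps_deriv_const_mult: "mps_deriv v (mps_const c * p) = mps_const c * mps_deriv v p"
  for p :: "('v, 'a :: comm_ring_1) mps"
  by (rule mps_eqI) simp

text \<open>The solution of \<open>e(g - \<i> \<phi>) = - q\<close> with \<open>g, \<phi>\<close> real, \<open>\<phi>(z, 0, u) = 0\<close> and \<open>g(0, 0, u) = b\<close>: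
  the terms of \<open>g - \<i> \<phi>\<close> that involve $\bar z$ but not \<open>z\<close> belong to \<open>g\<close>, so they are conjugate to
  terms already determined by \<open>q\<close>.\<close>

definition real_solve :: "cr_series \<Rightarrow> cr_series \<Rightarrow> cr_series" where
  "real_solve b q = euler_solve (cr_conj (euler_solve (cr_conj b) q)) q"

lemma scong_real_solve:
  assumes "scong (cr_vars n d) a k b b'" "scong (cr_vars n d) a k q q'"
  shows "scong (cr_vars n d) a k (real_solve b q) (real_solve b' q')"
  unfolding real_solve_def by (intro scong_euler_solve scong_conj assms)

lemma zdeg_conj_cr_vars:
  "set_mset m \<subseteq> cr_vars n d \<Longrightarrow>
    zdeg (image_mset conj_var m) = 0 \<longleftrightarrow> set_mset m \<inter> zbar_vars n = {}"
  by (auto simp: zdeg_conj_eq_0_iff cr_vars_def z_vars_def zbar_vars_def u_vars_def)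

lemma zdeg_cr_vars:
  "set_mset m \<subseteq> cr_vars n d \<Longrightarrow> zdeg m = 0 \<longleftrightarrow> set_mset m \<inter> z_vars n = {}"
  by (auto simp: zdeg_eq_0_iff cr_vars_def z_vars_def zbar_vars_def u_vars_def)

lemma set_zero_coeff_zbar:
  "p \<in> mps_in (cr_vars n d) \<Longrightarrow> mps_coeff (mps_set_zero (zbar_vars n) p) m =
    (if zdeg (image_mset conj_var m) = 0 then mps_coeff p m else 0)"
  using zdeg_conj_cr_vars[of m n d] by (auto simp: mps_in_def)

lemma set_zero_coeff_z_zbar:
  "p \<in> mps_in (cr_vars n d) \<Longrightarrow> mps_coeff (mps_set_zero (z_vars n \<union> zbar_vars n) p) m =
    (if zdeg m = 0 \<and> zdeg (image_mset conj_var m) = 0 then mps_coeff p m else 0)"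
proof (cases "mps_coeff p m = 0")
  case False
  moreover assume "p \<in> mps_in (cr_vars n d)"
  ultimately have "set_mset m \<subseteq> cr_vars n d"
    by (simp add: mps_in_def)
  then show ?thesis
    using zdeg_conj_cr_vars[of m n d] zdeg_cr_vars[of m n d] by auto
qed simp

text \<open>Three kinds of monomials exhaust the coefficients: with z, the Euler equation divides by
  \<open>zdeg m\<close>; with zbar but no z, reality transfers the value from the conjugate
  monomial; with u alone, \<phi> vanishes and g is \<open>b\<close>.\<close>

lemma real_solve_unique:
  fixes g \<phi> :: cr_series
  assumes V: "g \<in> mps_in (cr_vars n d)" "\<phi> \<in> mps_in (cr_vars n d)"
    and real: "real_valued g" "real_valued \<phi>"
    and g: "mps_set_zero (z_vars n \<union> zbar_vars n) g = b" and \<phi>: "mps_set_zero (zbar_vars n) \<phi> = 0"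
    and q: "\<And>m. of_nat (zdeg m) * mps_coeff (g - mps_const \<i> * \<phi>) m = - mps_coeff q m"
  shows "g - mps_const \<i> * \<phi> = real_solve b q"
proof (rule mps_eqI)
  fix m
  let ?h = "g - mps_const \<i> * \<phi>" and ?m = "image_mset conj_var m"
  have conj: "cnj (mps_coeff g (image_mset conj_var m)) = mps_coeff g m"
    "cnj (mps_coeff \<phi> (image_mset conj_var m)) = mps_coeff \<phi> m" for m
    using real by (simp_all only: real_valued_coeff)
  have \<phi>0: "mps_coeff \<phi> m = 0" if "zdeg (image_mset conj_var m) = 0" for m
    using set_zero_coeff_zbar[OF V(2), of m] that by (simp only: \<phi> zero_mps.rep_eq) simp
  have hq: "mps_coeff ?h m = - mps_coeff q m / of_nat (zdeg m)" if "zdeg m \<noteq> 0" for m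
    using q[of m] that by (simp add: field_simps del: minus_mps.rep_eq)
  consider "zdeg m \<noteq> 0" | "zdeg m = 0" "zdeg ?m \<noteq> 0" | "zdeg m = 0" "zdeg ?m = 0"
    by blast
  then show "mps_coeff ?h m = mps_coeff (real_solve b q) m"
  proof cases
    case 1
    then show ?thesis
      using hq by (simp add: real_solve_def del: minus_mps.rep_eq)
  next
    case 2
    \<comment> \<open>The monomial \<open>?m\<close> is free of zbar, so \<phi> vanishes there, and
      by reality also at \<open>m\<close>; at both, h coincides with g, whose two coefficients are
      conjugate.\<close>
    have "mps_coeff \<phi> m = 0" "mps_coeff \<phi> ?m = 0"
      using \<phi>0[of ?m] conj(2)[of m] 2(1) by auto
    then have "mps_coeff ?h m = cnj (mps_coeff ?h ?m)"
      using conj(1)[of m] by simp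
    also have "\<dots> = mps_coeff (real_solve b q) m"
      using 2 hq[OF 2(2)] by (simp add: real_solve_def del: minus_mps.rep_eq)
    finally show ?thesis .
  next
    case 3
    then have "mps_coeff b m = mps_coeff g m"
      using set_zero_coeff_z_zbar[OF V(1), of m] by (simp only: g) simp
    then show ?thesis
      using 3 \<phi>0[of m] by (simp add: real_solve_def)
  qed
qed

text \<open>The shape of \<open>real_solve\<close> accounts for all three claims: the outer
  conjugation turns \<open>cr_conj b\<close> back into \<open>b\<close> on monomials in u, and at
  monomials with zbar but no z it places the conjugates of the values found at the conjugate
  monomials.\<close>

lemma real_solve_correct:
  assumes V: "b \<in> mps_in (u_vars d)" "q \<in> mps_in (cr_vars n d)"
    and real: "real_valued b" and q: "\<And>m. zdeg m = 0 \<Longrightarrow> mps_coeff q m = 0"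
  defines "h \<equiv> real_solve b q"
  shows "mps_set_zero (z_vars n \<union> zbar_vars n) (re_part h) = b"
    and "mps_set_zero (zbar_vars n) (im_part h) = 0"
    and "of_nat (zdeg m) * mps_coeff h m = - mps_coeff q m"
proof -
  have b: "b \<in> mps_in (cr_vars n d)"
    using V(1) unfolding mps_in_def cr_vars_def by blast
  then have "h \<in> mps_in (cr_vars n d)"
    unfolding h_def real_solve_def using V(2)
    by (simp add: mps_in_eq_ord euler_solve_ord cr_conj_ord)
  then have parts: "re_part h \<in> mps_in (cr_vars n d)" "im_part h \<in> mps_in (cr_vars n d)"
    unfolding mps_in_eq_ord re_part_def im_part_def
    by (auto intro!: mps_ord_const_mult mps_ord_add mps_ord_diff cr_conj_ord)
  have conj: "cnj (mps_coeff b (image_mset conj_var m)) = mps_coeff b m" for m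
    using real by (rule real_valued_coeff)
  have b0: "mps_coeff b m = 0" if "zdeg m \<noteq> 0 \<or> zdeg (image_mset conj_var m) \<noteq> 0" for m
  proof (rule ccontr)
    assume "mps_coeff b m \<noteq> 0"
    then have "set_mset m \<subseteq> u_vars d"
      using V(1) by (simp add: mps_in_def)
    then have "zdeg m = 0" "zdeg (image_mset conj_var m) = 0"
      unfolding zdeg_conj_eq_0_iff by (auto simp: zdeg_eq_0_iff u_vars_def)
    with that show False
      by simp
  qed
  show "mps_set_zero (z_vars n \<union> zbar_vars n) (re_part h) = b"
  proof (rule mps_eqI)
    show "mps_coeff (mps_set_zero (z_vars n \<union> zbar_vars n) (re_part h)) m = mps_coeff b m" for m
      unfolding set_zero_coeff_z_zbar[OF parts(1)]
      using b0[of m] conj[of m] by (auto simp: re_part_def h_def real_solve_def)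
  qed
  show "mps_set_zero (zbar_vars n) (im_part h) = 0"
  proof (rule mps_eqI)
    show "mps_coeff (mps_set_zero (zbar_vars n) (im_part h)) m = mps_coeff 0 m" for m
      unfolding set_zero_coeff_zbar[OF parts(2)]
      using conj[of m] by (auto simp: im_part_def h_def real_solve_def)
  qed
  show "of_nat (zdeg m) * mps_coeff h m = - mps_coeff q m"
    using q[of m] by (auto simp: h_def real_solve_def)
qed

section \<open>Substitution of the change of coordinates\<close>

lemma map_mat_mcong:
  assumes "mcong V a k r c A B"
    and "\<And>p q. scong V a k p q \<Longrightarrow> scong V b l (F p) (G q)"
  shows "mcong V b l r c (map_mat F A) (map_mat G B)"
  using assms by (auto simp: mcong_def)

definition map_change :: "cr_series vec \<Rightarrow> cr_series vec \<Rightarrow> cr_var \<Rightarrow> cr_series" where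
  "map_change f g v = (case v of
      Z j \<Rightarrow> mps_var (Z j) + f $ j
    | Zbar j \<Rightarrow> mps_var (Zbar j) + cr_conj (f $ j)
    | U k \<Rightarrow> mps_var (U k) + g $ k)"

lemma along_map_eq: "along_map f g = mps_subst (map_change f g)"
  by (simp add: along_map_def map_change_def[abs_def])

lemma scong_map_change:
  assumes f: "vcong (cr_vars n d) 2 (Suc k) n f f'" and g: "vcong (cr_vars n d) 2 (Suc k) d g g'"
    and v: "v \<in> cr_vars n d"
  shows "scong (cr_vars n d) 1 (Suc k) (map_change f g v) (map_change f' g' v)"
    and "map_change f g v - mps_var v \<in> mps_ord (cr_vars n d) 2"
    and "map_change f' g' v - mps_var v \<in> mps_ord (cr_vars n d) 2"
proof -
  have "\<exists>x y. map_change f g v = mps_var v + x \<and> map_change f' g' v = mps_var v + y \<and>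
      scong (cr_vars n d) 2 (Suc k) x y"
    using v f g
    by (cases v) (auto simp: map_change_def cr_vars_def z_vars_def zbar_vars_def u_vars_def vcong_def
        intro: scong_conj[of n d, unfolded cr_vars_def z_vars_def zbar_vars_def u_vars_def])
  then obtain x y where xy: "map_change f g v = mps_var v + x" "map_change f' g' v = mps_var v + y"
      "scong (cr_vars n d) 2 (Suc k) x y"
    by blast
  show "scong (cr_vars n d) 1 (Suc k) (map_change f g v) (map_change f' g' v)"
    unfolding xy by (intro scong_add scong_refl mps_var_ord v scong_mono[OF xy(3)]) auto
  show "map_change f g v - mps_var v \<in> mps_ord (cr_vars n d) 2"
    "map_change f' g' v - mps_var v \<in> mps_ord (cr_vars n d) 2"
    using xy by (auto simp: scong_def)
qed

text \<open>Composition alone preserves agreement below \<open>k\<close>; a series minus its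
  composition gains a degree because the map is tangent to the identity. For that gain f and g agree
  one degree further than the series.\<close>

lemma scong_along_map:
  assumes f: "vcong (cr_vars n d) 2 (Suc k) n f f'" and g: "vcong (cr_vars n d) 2 (Suc k) d g g'"
    and p: "scong (cr_vars n d) 1 k p q"
  shows "scong (cr_vars n d) 1 k (along_map f g p) (along_map f' g' q)"
    and "scong (cr_vars n d) 1 (Suc k) (p - along_map f g p) (q - along_map f' g' q)"
proof -
  note change = scong_map_change[OF f g]
  show "scong (cr_vars n d) 1 k (along_map f g p) (along_map f' g' q)"
    unfolding along_map_eq by (rule scong_subst[OF finite_cr_vars p change(1)]) auto
  show "scong (cr_vars n d) 1 (Suc k) (p - along_map f g p) (q - along_map f' g' q)"
    unfolding along_map_eq
    by (rule scong_diff_subst[OF finite_cr_vars p, where l = k]) (simp, use change in blast)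
qed

lemma jac_carrier [simp]:
  "h \<in> carrier_vec r \<Longrightarrow> jac_z c h \<in> carrier_mat r c"
  "h \<in> carrier_vec r \<Longrightarrow> jac_zbar c h \<in> carrier_mat r c"
  "h \<in> carrier_vec r \<Longrightarrow> jac_u c h \<in> carrier_mat r c"
  by (auto simp: jac_z_def jac_zbar_def jac_u_def)

lemma mat_add_diff_cancel: "X \<in> carrier_mat r c \<Longrightarrow> Y \<in> carrier_mat r c \<Longrightarrow> X + Y - Y = X"
  and mat_diff_add_cancel: "X \<in> carrier_mat r c \<Longrightarrow> Y \<in> carrier_mat r c \<Longrightarrow> X - Y + Y = X"
  for X Y :: "'a :: ab_group_add mat"
  by (auto simp: mat_eq_iff)

lemma mult_euler_add:
  assumes "A \<in> carrier_mat r n" "B \<in> carrier_mat r n"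
  shows "(A + B) *\<^sub>v euler_field n = A *\<^sub>v euler_field n + B *\<^sub>v euler_field n"
  by (rule add_mult_distrib_mat_vec[OF assms]) (simp add: euler_field_def)


section \<open>Normalised quasi CR embeddings as fixed points\<close>

locale normalised_quasi_CR_embedding =
  fixes n d :: nat and Lb Lw :: "cr_series mat" and f0 g0 :: "cr_series vec"
  assumes L: "formal_almost_CR n d Lb Lw"
    and f0: "f0 \<in> vec_series n (z_vars n \<union> u_vars d)" "vec_no_constant_linear_terms f0"
    and g0: "g0 \<in> real_vec_series d (u_vars d)" "vec_no_constant_linear_terms g0"
begin

section \<open>The transformation rule, sorted by the source of its degree gain\<close>

abbreviation "V \<equiv> cr_vars n d"

lemma L_mcong: "mcong V 1 k n n Lb Lb" "mcong V 1 k d n Lw Lw"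
  using L by (auto simp: mcong_1_iff[unfolded One_nat_def] formal_almost_CR_def)

lemma L_carrier [simp]: "Lb \<in> carrier_mat n n" "Lw \<in> carrier_mat d n"
  using L_mcong[of 0] by (auto simp: mcong_def)

lemma jac_L_carrier [simp]:
  "h \<in> carrier_vec r \<Longrightarrow> jac_zbar n h * Lb \<in> carrier_mat r n"
  "h \<in> carrier_vec r \<Longrightarrow> jac_u d h * Lw \<in> carrier_mat r n"
  by (rule mult_carrier_mat[OF jac_carrier(2) L_carrier(1)]
    mult_carrier_mat[OF jac_carrier(3) L_carrier(2)]; assumption)+

lemma f0_vcong: "vcong V 2 k n f0 f0"
  using f0 vec_series_mono[of f0 n "z_vars n \<union> u_vars d" V] by (auto simp: vcong_2_iff cr_vars_def)

lemma g0_vcong: "vcong V 2 k d g0 g0"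
  using g0 vec_series_mono[of g0 d "u_vars d" V]
  by (auto simp: vcong_2_iff cr_vars_def real_vec_series_def)

text \<open>The identity plus this matrix expresses dz' through dz on the given (1,0) bundle. The
  identity is split off because the rest has order 1.\<close>

definition dz_part :: "cr_series vec \<Rightarrow> cr_series mat" where
  "dz_part f = jac_z n f + jac_zbar n f * Lb + jac_u d f * Lw"

text \<open>This is \<open>A\<close> minus the right-hand side of the rule with L' =
  \<open>A\<close>, which equals \<open>A\<close> to leading order. The two subtracted terms are
  kept apart because they gain their degree differently.\<close>

definition defect :: "cr_series vec \<Rightarrow> cr_series vec \<Rightarrow> cr_series mat \<Rightarrow> cr_series mat" where
  "defect f g A = A - map_mat (along_map f g) A - map_mat (along_map f g) A * dz_part f"

text \<open>The left-hand side of the zbar-equation without the z-derivative of conj f;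
  \<open>source_w\<close> is the analogue for the w-equation, without g_z. The omitted derivatives
  are the only ones on the left not multiplied by L.\<close>

definition source_b :: "cr_series vec \<Rightarrow> cr_series mat" where
  "source_b f = Lb + (jac_zbar n (map_vec cr_conj f) * Lb + jac_u d (map_vec cr_conj f) * Lw)"

definition source_w :: "cr_series vec \<Rightarrow> cr_series mat" where
  "source_w g = Lw + (jac_zbar n g * Lb + jac_u d g * Lw)"

text \<open>The rule is solved for L' minus the bare z-derivative: in the zbar-component this is P,
  in the w-component it is Q up to the correction i \<phi>_z - I(\<phi>).\<close>

lemma transforms_to_iff:
  assumes f: "f \<in> carrier_vec n" and g: "g \<in> carrier_vec d"
    and A: "A \<in> carrier_mat n n" and B: "B \<in> carrier_mat d n"
  shows "transforms_to n d f g Lb Lw A B \<longleftrightarrow>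
    defect f g A + source_b f = A - jac_z n (map_vec cr_conj f) \<and>
    defect f g B + source_w g = B - jac_z n g"
proof -
  let ?S = "map_mat (along_map f g)" and ?fb = "map_vec cr_conj f"
  have fb: "?fb \<in> carrier_vec n"
    using f by simp
  have dz: "dz_part f \<in> carrier_mat n n"
    unfolding dz_part_def using f by simp
  \<comment> \<open>Entrywise bookkeeping: \<open>X\<close> is a component of L', \<open>T\<close>
    its composition with the map, \<open>W\<close> the product with \<open>dz_part f\<close>,
    \<open>J\<close> the bare z-derivative, and \<open>K\<close>, \<open>M\<close>, \<open>N\<close>
    the summands of the source.\<close>
  have rearrange: "X - T - W + (K + (M + N)) = X - J \<longleftrightarrow> J + (K + M) + N = T + W"
    if "X \<in> carrier_mat r n" "T \<in> carrier_mat r n" "W \<in> carrier_mat r n" "K \<in> carrier_mat r n"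
      "M \<in> carrier_mat r n" "N \<in> carrier_mat r n" "J \<in> carrier_mat r n"
    for r and X T W K M N J :: "cr_series mat"
  proof -
    have ring: "x - t - w + (k + (m + l)) = x - j \<longleftrightarrow> j + (k + m) + l = t + w"
      for x t w k m l j :: cr_series
      by (auto simp: algebra_simps)
    show ?thesis
      using that by (auto simp: mat_eq_iff ring add.assoc)
  qed
  have "1\<^sub>m n + jac_z n f + jac_zbar n f * Lb + jac_u d f * Lw = 1\<^sub>m n + dz_part f"
    unfolding dz_part_def using f by (simp add: assoc_add_mat[of _ n n])
  then have mult_dz: "?S X * (1\<^sub>m n + jac_z n f + jac_zbar n f * Lb + jac_u d f * Lw)
      = ?S X + ?S X * dz_part f" if "X \<in> carrier_mat r n" for r X
    using that dz by (simp add: mult_add_distrib_mat[of "?S X" r n "1\<^sub>m n" n])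
  have b: "(1\<^sub>m n + jac_zbar n ?fb) * Lb = Lb + jac_zbar n ?fb * Lb"
    using add_mult_distrib_mat[of "1\<^sub>m n" n n "jac_zbar n ?fb" Lb n] fb
    by (simp add: left_mult_one_mat[OF L_carrier(1)])
  have w: "jac_z n g + jac_zbar n g * Lb + (1\<^sub>m d + jac_u d g) * Lw
      = jac_z n g + (Lw + jac_zbar n g * Lb) + jac_u d g * Lw"
  proof -
    have swap: "J + M + (K + N) = J + (K + M) + N"
      if "J \<in> carrier_mat d n" "M \<in> carrier_mat d n" "K \<in> carrier_mat d n" "N \<in> carrier_mat d n"
      for J M K N :: "cr_series mat"
      using that by (intro eq_matI) (auto simp: ac_simps)
    have "(1\<^sub>m d + jac_u d g) * Lw = Lw + jac_u d g * Lw"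
      using add_mult_distrib_mat[of "1\<^sub>m d" d d "jac_u d g" Lw n] g
      by (simp add: left_mult_one_mat[OF L_carrier(2)])
    then show ?thesis
      using g by (simp only:) (rule swap, simp_all)
  qed
  have iff_b: "defect f g A + source_b f = A - jac_z n ?fb \<longleftrightarrow>
      jac_z n ?fb + (Lb + jac_zbar n ?fb * Lb) + jac_u d ?fb * Lw = ?S A + ?S A * dz_part f"
    unfolding defect_def source_b_def by (rule rearrange) (use A dz fb in \<open>auto\<close>)
  have iff_w: "defect f g B + source_w g = B - jac_z n g \<longleftrightarrow>
      jac_z n g + (Lw + jac_zbar n g * Lb) + jac_u d g * Lw = ?S B + ?S B * dz_part f"
    unfolding defect_def source_w_def by (rule rearrange) (use B dz g in \<open>auto\<close>)
  show ?thesis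
    unfolding transforms_to_def Let_def mult_dz[OF A] mult_dz[OF B] b w iff_b iff_w by blast
qed

lemma mcong_dz_part:
  assumes "vcong V 2 (Suc k) n f f'"
  shows "mcong V 1 k n n (dz_part f) (dz_part f')"
proof -
  have f: "vcong V (Suc 1) (Suc k) n f f'"
    using assms by (simp add: numeral_2_eq_2)
  have "mcong V (1 + 1) k n n (jac_zbar n f * Lb) (jac_zbar n f' * Lb)"
    "mcong V (1 + 1) k n n (jac_u d f * Lw) (jac_u d f' * Lw)"
    by (rule mcong_mult[OF mcong_jac(2)[OF f] L_mcong(1)[of k]]
      mcong_mult[OF mcong_jac(3)[OF f] L_mcong(2)[of k]]; simp)+
  from this[THEN mcong_mono, of 1 k] show ?thesis
    unfolding dz_part_def by (intro mcong_add mcong_jac(1)[OF f]) auto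
qed

text \<open>The derivatives lose one degree of agreement; the factor L, vanishing at 0, restores
  it.\<close>

lemma mcong_source:
  assumes "vcong V 2 (Suc k) r f f'"
  shows "mcong V 1 (Suc k) r n (jac_zbar n f * Lb + jac_u d f * Lw) (jac_zbar n f' * Lb + jac_u d f' * Lw)"
proof -
  have f: "vcong V (Suc 1) (Suc k) r f f'"
    using assms by (simp add: numeral_2_eq_2)
  have "mcong V (1 + 1) (Suc k) r n (jac_zbar n f * Lb) (jac_zbar n f' * Lb)"
    "mcong V (1 + 1) (Suc k) r n (jac_u d f * Lw) (jac_u d f' * Lw)"
    by (rule mcong_mult[OF mcong_jac(2)[OF f] L_mcong(1)[of k]]
      mcong_mult[OF mcong_jac(3)[OF f] L_mcong(2)[of k]]; simp)+
  from this[THEN mcong_mono, of 1 "Suc k"] show ?thesis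
    by (intro mcong_add) auto
qed

text \<open>\<open>A\<close> minus its composition gains a degree by tangency to the identity; the
  composition times \<open>dz_part f\<close> gains one as a product of two matrices of order
  1.\<close>

lemma mcong_defect:
  assumes f: "vcong V 2 (Suc k) n f f'" and g: "vcong V 2 (Suc k) d g g'"
    and A: "mcong V 1 k r n A A'"
  shows "mcong V 1 (Suc k) r n (defect f g A) (defect f' g' A')"
proof -
  let ?S = "map_mat (along_map f g)" and ?S' = "map_mat (along_map f' g')"
  have S: "mcong V 1 k r n (?S A) (?S' A')"
    by (rule map_mat_mcong[OF A scong_along_map(1)[OF f g]])
  have "mcong V (1 + 1) (Suc k) r n (?S A * dz_part f) (?S' A' * dz_part f')"
    by (rule mcong_mult[OF S mcong_dz_part[OF f]]) auto
  then have "mcong V 1 (Suc k) r n (?S A * dz_part f) (?S' A' * dz_part f')"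
    by (rule mcong_mono) auto
  moreover have "mcong V 1 (Suc k) r n (A - ?S A) (A' - ?S' A')"
    using A S scong_along_map(2)[OF f g] by (auto simp: mcong_def)
  ultimately show ?thesis
    unfolding defect_def by (blast intro: mcong_diff)
qed

text \<open>The conjugate of f is the series to solve for: the rule differentiates it in z at
  leading order, and its part free of z is the conjugate of the prescribed f(z, 0, u).\<close>

definition sol_fbar :: "cr_series mat \<Rightarrow> cr_series vec" where
  "sol_fbar P = vec n (\<lambda>i. euler_solve (cr_conj (f0 $ i)) ((P *\<^sub>v euler_field n) $ i))"

definition sol_f :: "cr_series mat \<Rightarrow> cr_series vec" where
  "sol_f P = map_vec cr_conj (sol_fbar P)"

definition sol_h :: "cr_series mat \<Rightarrow> cr_series vec" where
  "sol_h Q = vec d (\<lambda>i. real_solve (g0 $ i) ((Q *\<^sub>v euler_field n) $ i))"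

definition sol_g :: "cr_series mat \<Rightarrow> cr_series vec" where
  "sol_g Q = map_vec re_part (sol_h Q)"

definition sol_phi :: "cr_series mat \<Rightarrow> cr_series vec" where
  "sol_phi Q = map_vec im_part (sol_h Q)"

lemma map_conj_sol_f: "map_vec cr_conj (sol_f P) = sol_fbar P"
  by (simp add: sol_f_def vec_eq_iff)

lemma vcong_sol_fbar: "mcong V 1 k n n P P' \<Longrightarrow> vcong V 2 (Suc k) n (sol_fbar P) (sol_fbar P')"
  using f0_vcong[of "Suc k"] scong_mult_euler[of n d 1 k n P P']
  by (auto simp: vcong_def sol_fbar_def numeral_2_eq_2 intro!: scong_euler_solve scong_conj)

lemma vcong_sol_f: "mcong V 1 k n n P P' \<Longrightarrow> vcong V 2 (Suc k) n (sol_f P) (sol_f P')"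
  unfolding sol_f_def by (intro vcong_conj vcong_sol_fbar)

lemma vcong_sol_h: "mcong V 1 k d n Q Q' \<Longrightarrow> vcong V 2 (Suc k) d (sol_h Q) (sol_h Q')"
  using g0_vcong[of "Suc k"] scong_mult_euler[of n d 1 k d Q Q']
  by (auto simp: vcong_def sol_h_def numeral_2_eq_2 intro!: scong_real_solve)

lemma vcong_sol_g: "mcong V 1 k d n Q Q' \<Longrightarrow> vcong V 2 (Suc k) d (sol_g Q) (sol_g Q')"
  and vcong_sol_phi: "mcong V 1 k d n Q Q' \<Longrightarrow> vcong V 2 (Suc k) d (sol_phi Q) (sol_phi Q')"
  using vcong_sol_h[of k Q Q']
  by (auto simp: vcong_def sol_g_def sol_phi_def intro!: scong_re_im_part)

text \<open>Recovers the zbar-component of L' from P, as \<open>struct_w\<close> recovers the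
  w-component from Q.\<close>

definition struct_b :: "cr_series mat \<Rightarrow> cr_series mat" where
  "struct_b P = P + jac_z n (sol_fbar P)"

definition struct_w :: "cr_series mat \<Rightarrow> cr_series mat" where
  "struct_w Q = Q + (jac_z n (sol_h Q) + induced_w n d (sol_phi Q))"

lemma mcong_struct:
  "mcong V 1 k n n P P' \<Longrightarrow> mcong V 1 k n n (struct_b P) (struct_b P')"
  "mcong V 1 k d n Q Q' \<Longrightarrow> mcong V 1 k d n (struct_w Q) (struct_w Q')"
  unfolding struct_b_def struct_w_def
  using mcong_jac(1)[of V 1 k] mcong_induced_w(1)[of V k d] vcong_sol_fbar[of k P P']
    vcong_sol_h[of k Q Q'] vcong_sol_phi[of k Q Q']
  by (auto simp: numeral_2_eq_2 intro!: mcong_add)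

text \<open>The extra matrix in the second component arises because Q subtracts h_z + I(\<phi>)
  instead of g_z, and - (h_z + I(\<phi>)) = - g_z + (i \<phi>_z - I(\<phi>)).\<close>

definition step :: "cr_series mat \<times> cr_series mat \<Rightarrow> cr_series mat \<times> cr_series mat" where
  "step X = (let P = fst X; Q = snd X; f = sol_f P; g = sol_g Q; \<phi> = sol_phi Q in
    (defect f g (struct_b P) + source_b f,
     defect f g (struct_w Q) + (source_w g + (mps_const \<i> \<cdot>\<^sub>m jac_z n \<phi> - induced_w n d \<phi>))))"

lemma mcong_step:
  assumes P: "mcong V 1 k n n P P'" and Q: "mcong V 1 k d n Q Q'"
  shows "mcong V 1 (Suc k) n n (fst (step (P, Q))) (fst (step (P', Q')))"
    and "mcong V 1 (Suc k) d n (snd (step (P, Q))) (snd (step (P', Q')))"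
  unfolding step_def Let_def fst_conv snd_conv source_b_def source_w_def
  by (intro mcong_add mcong_defect vcong_sol_f vcong_sol_g mcong_struct P Q L_mcong mcong_source
      vcong_conj mcong_induced_w(2) vcong_sol_phi)+

lemma step_fixpoint: "\<exists>!X. (mcong V 1 0 n n (fst X) (fst X) \<and> mcong V 1 0 d n (snd X) (snd X)) \<and> step X = X"
  by (rule mat_pair_fixpoint) (use mcong_step in \<open>auto simp del: One_nat_def\<close>)

lemma sol_h_eq: "sol_h Q = vec d (\<lambda>i. sol_g Q $ i - mps_const \<i> * sol_phi Q $ i)"
  by (rule eq_vecI) (auto simp: sol_h_def sol_g_def sol_phi_def re_part_minus_im_part)

lemma jac_z_diff_ii_mult:
  "g \<in> carrier_vec d \<Longrightarrow> \<phi> \<in> carrier_vec d \<Longrightarrow>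
    jac_z n (vec d (\<lambda>i. g $ i - mps_const \<i> * \<phi> $ i)) = jac_z n g - mps_const \<i> \<cdot>\<^sub>m jac_z n \<phi>"
  by (rule eq_matI) (auto simp: jac_z_def mps_deriv_diff mps_deriv_const_mult)

text \<open>The Euler equations are already built into \<open>sol_f\<close>, \<open>sol_g\<close>
  and \<open>sol_phi\<close>, so the fixed point equation has only the transformation rule left to
  express.\<close>

lemma step_iff:
  assumes P: "mcong V 1 0 n n P P" and Q: "mcong V 1 0 d n Q Q"
  shows "step (P, Q) = (P, Q) \<longleftrightarrow>
    transforms_to n d (sol_f P) (sol_g Q) Lb Lw (struct_b P) (struct_w Q)"
proof -
  let ?f = "sol_f P" and ?g = "sol_g Q" and ?\<phi> = "sol_phi Q" and ?I = "induced_w n d (sol_phi Q)"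
  let ?Z = "mps_const \<i> \<cdot>\<^sub>m jac_z n ?\<phi>"
  have c: "P \<in> carrier_mat n n" "Q \<in> carrier_mat d n" "?f \<in> carrier_vec n" "?g \<in> carrier_vec d"
    "?\<phi> \<in> carrier_vec d" "sol_fbar P \<in> carrier_vec n" "?I \<in> carrier_mat d n"
    "struct_b P \<in> carrier_mat n n" "struct_w Q \<in> carrier_mat d n"
    using P Q vcong_sol_f[OF P] vcong_sol_fbar[OF P] vcong_sol_g[OF Q] vcong_sol_phi[OF Q]
      mcong_induced_w(1)[OF vcong_sol_phi[OF Q]] mcong_struct(1)[OF P] mcong_struct(2)[OF Q]
    by (auto simp: mcong_def vcong_def)
  have D: "defect ?f ?g (struct_w Q) \<in> carrier_mat d n" "source_w ?g \<in> carrier_mat d n"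
    using mcong_carrier[OF mcong_defect[OF vcong_sol_f[OF P] vcong_sol_g[OF Q] mcong_struct(2)[OF Q]]] c
    by (auto simp: source_w_def)
  have w: "M + (N + (Z - I)) = X \<longleftrightarrow> M + N = X + ((G - Z) + I) - G"
    if "M \<in> carrier_mat d n" "N \<in> carrier_mat d n" "Z \<in> carrier_mat d n" "I \<in> carrier_mat d n"
      "X \<in> carrier_mat d n" "G \<in> carrier_mat d n" for M N Z I X G :: "cr_series mat"
  proof -
    show ?thesis
      using that unfolding mat_eq_iff by (auto simp: algebra_simps)
  qed
  have "struct_b P - jac_z n (map_vec cr_conj ?f) = P"
    unfolding map_conj_sol_f struct_b_def by (rule mat_add_diff_cancel[OF c(1) jac_carrier(1)[OF c(6)]])
  moreover have "defect ?f ?g (struct_w Q) + (source_w ?g + (?Z - ?I)) = Q \<longleftrightarrow>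
      defect ?f ?g (struct_w Q) + source_w ?g = struct_w Q - jac_z n ?g"
  proof -
    have "struct_w Q = Q + ((jac_z n ?g - ?Z) + ?I)"
      unfolding struct_w_def sol_h_eq using c by (simp add: jac_z_diff_ii_mult)
    then have "struct_w Q - jac_z n ?g = Q + ((jac_z n ?g - ?Z) + ?I) - jac_z n ?g"
      by (simp only:)
    then show ?thesis
      using c by (simp only:) (rule w[OF D], simp_all)
  qed
  ultimately show ?thesis
    unfolding transforms_to_iff[OF c(3,4,8,9)] step_def Let_def fst_conv snd_conv prod.inject
    by simp
qed

section \<open>Correspondence between fixed points and normalised embeddings\<close>

lemma f0_coeff: "i < n \<Longrightarrow> zdeg (image_mset conj_var m) \<noteq> 0 \<Longrightarrow> mps_coeff (f0 $ i) m = 0"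
proof (rule ccontr)
  assume "i < n" "zdeg (image_mset conj_var m) \<noteq> 0" "mps_coeff (f0 $ i) m \<noteq> 0"
  with f0(1) have "set_mset m \<subseteq> z_vars n \<union> u_vars d"
    by (simp add: vec_series_def mps_in_def)
  then have "zdeg (image_mset conj_var m) = 0"
    unfolding zdeg_conj_eq_0_iff by (auto simp: z_vars_def u_vars_def)
  then show False
    using \<open>zdeg (image_mset conj_var m) \<noteq> 0\<close> by simp
qed

lemma fixpoint_embedding:
  assumes P: "mcong V 1 0 n n P P" and Q: "mcong V 1 0 d n Q Q" and fp: "step (P, Q) = (P, Q)"
  shows "quasi_CR_embedding n d Lb Lw (sol_f P) (sol_g Q) (sol_phi Q)"
    and "map_vec (mps_set_zero (zbar_vars n)) (sol_f P) = f0"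
    and "map_vec (mps_set_zero (z_vars n \<union> zbar_vars n)) (sol_g Q) = g0"
    and "map_vec (mps_set_zero (zbar_vars n)) (sol_phi Q) = 0\<^sub>v d"
proof -
  let ?I = "induced_w n d (sol_phi Q)"
  have f: "vcong V 2 0 n (sol_f P) (sol_f P)" and fb: "vcong V 2 0 n (sol_fbar P) (sol_fbar P)"
    and g: "vcong V 2 0 d (sol_g Q) (sol_g Q)" and h: "vcong V 2 0 d (sol_h Q) (sol_h Q)"
    and \<phi>: "vcong V 2 0 d (sol_phi Q) (sol_phi Q)"
    using vcong_sol_f[OF P] vcong_sol_fbar[OF P] vcong_sol_g[OF Q] vcong_sol_h[OF Q] vcong_sol_phi[OF Q]
    by (auto simp: vcong_refl_iff)
  have c: "P \<in> carrier_mat n n" "Q \<in> carrier_mat d n" "?I \<in> carrier_mat d n"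
    "sol_fbar P \<in> carrier_vec n" "sol_h Q \<in> carrier_vec d" "f0 \<in> carrier_vec n" "g0 \<in> carrier_vec d"
    using P Q mcong_induced_w(1)[OF vcong_sol_phi[OF Q]] fb h f0(1) g0(1)
    by (auto simp: mcong_def vcong_def vec_series_def real_vec_series_def)
  have V: "sol_f P $ i \<in> mps_in V" "sol_fbar P $ i \<in> mps_in V" if "i < n" for i
    using f fb that by (auto simp: vcong_refl_iff mps_in_eq_ord intro: mps_ord_mono)
  have Vh: "sol_h Q $ i \<in> mps_in V" "(Q *\<^sub>v euler_field n) $ i \<in> mps_in V" if "i < d" for i
    using h that scong_mult_euler[OF Q that]
    by (auto simp: vcong_refl_iff mps_in_eq_ord scong_def intro: mps_ord_mono)
  show "map_vec (mps_set_zero (zbar_vars n)) (sol_f P) = f0"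
  proof (rule eq_vecI)
    fix i assume "i < dim_vec f0"
    with c have i: "i < n"
      by simp
    \<comment> \<open>Conjugation carries monomials of f free of zbar to monomials of conj f free of
      z, where \<open>euler_solve\<close> returns its first argument; where zbar occurs,
      \<open>f0\<close> has no terms.\<close>
    have "mps_set_zero (zbar_vars n) (sol_f P $ i) = f0 $ i"
    proof (rule mps_eqI)
      show "mps_coeff (mps_set_zero (zbar_vars n) (sol_f P $ i)) m = mps_coeff (f0 $ i) m" for m
        unfolding set_zero_coeff_zbar[OF V(1)[OF i]]
        using i f0_coeff[OF i, of m] by (auto simp: sol_f_def sol_fbar_def)
    qed
    then show "map_vec (mps_set_zero (zbar_vars n)) (sol_f P) $ i = f0 $ i"
      using i by (simp add: sol_f_def sol_fbar_def)
  qed (use c in \<open>simp add: sol_f_def\<close>)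
  have rs: "mps_set_zero (z_vars n \<union> zbar_vars n) (re_part (sol_h Q $ i)) = g0 $ i"
    "mps_set_zero (zbar_vars n) (im_part (sol_h Q $ i)) = 0"
    "of_nat (zdeg m) * mps_coeff (sol_h Q $ i) m = - mps_coeff ((Q *\<^sub>v euler_field n) $ i) m"
    if i: "i < d" for i m
  proof -
    have "g0 $ i \<in> mps_in (u_vars d)" "real_valued (g0 $ i)"
      using g0(1) i by (auto simp: real_vec_series_def vec_series_def)
    note rs = real_solve_correct[OF this(1) Vh(2)[OF i] this(2) mult_euler_coeff_zdeg_0[OF c(2) i]]
    show "mps_set_zero (z_vars n \<union> zbar_vars n) (re_part (sol_h Q $ i)) = g0 $ i"
      "mps_set_zero (zbar_vars n) (im_part (sol_h Q $ i)) = 0"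
      "of_nat (zdeg m) * mps_coeff (sol_h Q $ i) m = - mps_coeff ((Q *\<^sub>v euler_field n) $ i) m"
      using rs i by (simp_all add: sol_h_def)
  qed
  show "map_vec (mps_set_zero (z_vars n \<union> zbar_vars n)) (sol_g Q) = g0"
    "map_vec (mps_set_zero (zbar_vars n)) (sol_phi Q) = 0\<^sub>v d"
    using rs(1,2) c by (auto simp: sol_g_def sol_phi_def intro!: eq_vecI)
  have euler_b: "struct_b P *\<^sub>v euler_field n = 0\<^sub>v n"
  proof (rule eq_vecI)
    fix i assume "i < dim_vec (0\<^sub>v n :: cr_series vec)"
    then have i: "i < n"
      by simp
    \<comment> \<open>At monomials with z the factor \<open>zdeg m\<close> undoes the division in
      \<open>euler_solve\<close>; at the others both summands vanish.\<close>
    have "(P *\<^sub>v euler_field n) $ i + (jac_z n (sol_fbar P) *\<^sub>v euler_field n) $ i = 0"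
    proof (rule mps_eqI)
      show "mps_coeff ((P *\<^sub>v euler_field n) $ i + (jac_z n (sol_fbar P) *\<^sub>v euler_field n) $ i) m
          = mps_coeff 0 m" for m
        unfolding plus_mps.rep_eq euler_jac_z_coeff[OF c(4) i V(2)[OF i]]
        using mult_euler_coeff_zdeg_0[OF c(1) i, of m] i by (auto simp: sol_fbar_def)
    qed
    then show "(struct_b P *\<^sub>v euler_field n) $ i = (0\<^sub>v n :: cr_series vec) $ i"
      unfolding struct_b_def mult_euler_add[OF c(1) jac_carrier(1)[OF c(4)]]
      using i c by (subst index_add_vec) (auto simp: jac_z_def)
  qed (use c in \<open>simp add: struct_b_def jac_z_def\<close>)
  have euler_w: "struct_w Q *\<^sub>v euler_field n = ?I *\<^sub>v euler_field n"
  proof (rule eq_vecI)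
    fix i assume "i < dim_vec (?I *\<^sub>v euler_field n)"
    with c have i: "i < d"
      by simp
    \<comment> \<open>After this cancellation only the induced structure survives in
      \<open>struct_w Q\<close> along the Euler field.\<close>
    have "(Q *\<^sub>v euler_field n) $ i + (jac_z n (sol_h Q) *\<^sub>v euler_field n) $ i = 0"
    proof (rule mps_eqI)
      show "mps_coeff ((Q *\<^sub>v euler_field n) $ i + (jac_z n (sol_h Q) *\<^sub>v euler_field n) $ i) m
          = mps_coeff 0 m" for m
        unfolding plus_mps.rep_eq euler_jac_z_coeff[OF c(5) i Vh(1)[OF i]] rs(3)[OF i] by simp
    qed
    moreover have J: "jac_z n (sol_h Q) \<in> carrier_mat d n"
      by (rule jac_carrier(1)[OF c(5)])
    moreover have "(struct_w Q *\<^sub>v euler_field n) $ i = (Q *\<^sub>v euler_field n) $ i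
        + ((jac_z n (sol_h Q) *\<^sub>v euler_field n) $ i + (?I *\<^sub>v euler_field n) $ i)"
      unfolding struct_w_def mult_euler_add[OF c(2) add_carrier_mat[OF c(3)]] mult_euler_add[OF J c(3)]
      using i c J by (simp del: index_mult_mat_vec)
    ultimately show "(struct_w Q *\<^sub>v euler_field n) $ i = (?I *\<^sub>v euler_field n) $ i"
      by (simp only: add.assoc[symmetric] add_0_left)
  qed (use c in \<open>simp add: struct_w_def\<close>)
  have "formal_almost_CR n d (struct_b P) (struct_w Q)"
    using mcong_struct(1)[OF P] mcong_struct(2)[OF Q] mcong_1_iff[of V 0]
    unfolding formal_almost_CR_def by (metis mcong_refl)
  moreover have "real_valued (sol_g Q $ i)" "real_valued (sol_phi Q $ i)" if "i < d" for i
    using that by (simp_all add: sol_g_def sol_phi_def sol_h_def real_valued_re_part real_valued_im_part)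
  ultimately show "quasi_CR_embedding n d Lb Lw (sol_f P) (sol_g Q) (sol_phi Q)"
    using f g \<phi> fp euler_b euler_w step_iff[OF P Q]
    unfolding quasi_CR_embedding_def vcong_2_iff real_vec_series_def by blast
qed

text \<open>The direction that yields uniqueness: P and Q are read off from the transformed
  structure, and the Euler conditions together with the normalisations leave no further freedom in
  f, g, \<phi>.\<close>

lemma embedding_fixpoint:
  assumes emb: "quasi_CR_embedding n d Lb Lw f g \<phi>"
    and f: "map_vec (mps_set_zero (zbar_vars n)) f = f0"
    and g: "map_vec (mps_set_zero (z_vars n \<union> zbar_vars n)) g = g0"
    and \<phi>: "map_vec (mps_set_zero (zbar_vars n)) \<phi> = 0\<^sub>v d"
  obtains P Q where "mcong V 1 0 n n P P" "mcong V 1 0 d n Q Q" "step (P, Q) = (P, Q)"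
    "f = sol_f P" "g = sol_g Q" "\<phi> = sol_phi Q"
proof -
  obtain A B where AB: "formal_almost_CR n d A B" "transforms_to n d f g Lb Lw A B"
    "A *\<^sub>v euler_field n = 0\<^sub>v n" "B *\<^sub>v euler_field n = induced_w n d \<phi> *\<^sub>v euler_field n"
    using emb unfolding quasi_CR_embedding_def by blast
  define fb where "fb = map_vec cr_conj f"
  define h where "h = vec d (\<lambda>i. g $ i - mps_const \<i> * \<phi> $ i)"
  define J K I where "J = jac_z n fb" and "K = jac_z n h" and "I = induced_w n d \<phi>"
  define P Q where "P = A - J" and "Q = B - (K + I)"
  have v: "vcong V 2 (Suc 0) n f f" "vcong V 2 (Suc 0) d g g" "vcong V 2 (Suc 0) d \<phi> \<phi>"
    using emb unfolding quasi_CR_embedding_def vcong_2_iff real_vec_series_def by auto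
  have vfb: "vcong V 2 (Suc 0) n fb fb"
    unfolding fb_def by (rule vcong_conj[OF v(1)])
  have vh: "vcong V 2 (Suc 0) d h h"
    using v by (auto simp: vcong_refl_iff h_def intro!: mps_ord_diff mps_ord_const_mult)
  have m: "mcong V 1 0 n n A A" "mcong V 1 0 d n B B"
    using AB(1) by (auto simp: mcong_1_iff[unfolded One_nat_def] formal_almost_CR_def)
  have JKI: "mcong V 1 0 n n J J" "mcong V 1 0 d n K K" "mcong V 1 0 d n I I"
    unfolding J_def K_def I_def
    using mcong_jac(1)[of V 1 0] vfb vh mcong_induced_w(1)[OF v(3)] by (auto simp: numeral_2_eq_2)
  have P: "mcong V 1 0 n n P P" and Q: "mcong V 1 0 d n Q Q"
    unfolding P_def Q_def by (intro mcong_diff mcong_add m JKI)+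
  have c: "A \<in> carrier_mat n n" "B \<in> carrier_mat d n" "J \<in> carrier_mat n n" "K \<in> carrier_mat d n"
    "I \<in> carrier_mat d n" "P \<in> carrier_mat n n" "Q \<in> carrier_mat d n"
    "f \<in> carrier_vec n" "fb \<in> carrier_vec n" "g \<in> carrier_vec d" "h \<in> carrier_vec d" "\<phi> \<in> carrier_vec d"
    using m JKI P Q v vfb vh by (auto simp: mcong_def vcong_def)
  have A: "A = P + J" and B: "B = Q + (K + I)"
    unfolding P_def Q_def
    by (simp_all only: mat_diff_add_cancel[OF c(1,3)] mat_diff_add_cancel[OF c(2) add_carrier_mat[OF c(5)]])
  have eb: "mps_coeff ((P *\<^sub>v euler_field n) $ i) m = - (of_nat (zdeg m) * mps_coeff (fb $ i) m)"
    if i: "i < n" for i m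
  proof -
    have "(P *\<^sub>v euler_field n) $ i + (J *\<^sub>v euler_field n) $ i = (A *\<^sub>v euler_field n) $ i"
      unfolding A mult_euler_add[OF c(6,3)] using i c by (simp del: index_mult_mat_vec)
    also have "\<dots> = 0"
      using AB(3) i by simp
    finally have "mps_coeff ((P *\<^sub>v euler_field n) $ i) m = - mps_coeff ((J *\<^sub>v euler_field n) $ i) m"
      unfolding mps_eq_iff by (simp add: eq_neg_iff_add_eq_0)
    also have "mps_coeff ((J *\<^sub>v euler_field n) $ i) m = of_nat (zdeg m) * mps_coeff (fb $ i) m"
      unfolding J_def using vfb i
      by (intro euler_jac_z_coeff[OF c(9)]) (auto simp: vcong_refl_iff mps_in_eq_ord intro: mps_ord_mono)
    finally show ?thesis .
  qed
  have ew: "of_nat (zdeg m) * mps_coeff (h $ i) m = - mps_coeff ((Q *\<^sub>v euler_field n) $ i) m"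
    if i: "i < d" for i m
  proof -
    have "(Q *\<^sub>v euler_field n) $ i + ((K *\<^sub>v euler_field n) $ i + (I *\<^sub>v euler_field n) $ i)
        = (B *\<^sub>v euler_field n) $ i"
      unfolding B mult_euler_add[OF c(7) add_carrier_mat[OF c(5)]] mult_euler_add[OF c(4,5)]
      using i c by (simp del: index_mult_mat_vec)
    also have "\<dots> = (I *\<^sub>v euler_field n) $ i"
      using AB(4) by (simp add: I_def)
    finally have "(Q *\<^sub>v euler_field n) $ i + (K *\<^sub>v euler_field n) $ i = 0"
      by (simp only: add.assoc[symmetric] add_cancel_left_left)
    then have "mps_coeff ((K *\<^sub>v euler_field n) $ i) m = - mps_coeff ((Q *\<^sub>v euler_field n) $ i) m"
      unfolding mps_eq_iff by (simp add: eq_neg_iff_add_eq_0 add.commute)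
    moreover have "mps_coeff ((K *\<^sub>v euler_field n) $ i) m = of_nat (zdeg m) * mps_coeff (h $ i) m"
      unfolding K_def using vh i
      by (intro euler_jac_z_coeff[OF c(11)]) (auto simp: vcong_refl_iff mps_in_eq_ord intro: mps_ord_mono)
    ultimately show ?thesis
      by simp
  qed
  \<comment> \<open>Coefficients at monomials with z come from \<open>eb\<close>; those without z
    are conjugate to coefficients of f free of zbar, prescribed by \<open>f0\<close>.\<close>
  have fb: "fb = sol_fbar P"
  proof (rule eq_vecI)
    fix i assume "i < dim_vec (sol_fbar P)"
    then have i: "i < n"
      by (simp add: sol_fbar_def)
    have fi: "f $ i \<in> mps_in V"
      using v(1) i by (auto simp: vcong_refl_iff mps_in_eq_ord intro: mps_ord_mono)
    have f0i: "f0 $ i = mps_set_zero (zbar_vars n) (f $ i)"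
      using i c by (simp flip: f)
    show "fb $ i = sol_fbar P $ i"
    proof (rule mps_eqI)
      show "mps_coeff (fb $ i) m = mps_coeff (sol_fbar P $ i) m" for m
        using eb[OF i, of m] set_zero_coeff_zbar[OF fi, of "image_mset conj_var m"] i c
        by (simp add: sol_fbar_def f0i fb_def del: mps_set_zero.rep_eq)
    qed
  qed (use c in \<open>simp add: sol_fbar_def\<close>)
  then have f_eq: "f = sol_f P"
    unfolding sol_f_def by (simp add: fb_def vec_eq_iff flip: fb)
  have real: "real_valued (g $ i)" "real_valued (\<phi> $ i)" if "i < d" for i
    using emb that by (auto simp: quasi_CR_embedding_def real_vec_series_def)
  have h_eq: "h = sol_h Q"
  proof (rule eq_vecI)
    fix i assume "i < dim_vec (sol_h Q)"
    then have i: "i < d"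
      by (simp add: sol_h_def)
    have "g $ i \<in> mps_in V" "\<phi> $ i \<in> mps_in V"
      using v i by (auto simp: vcong_refl_iff mps_in_eq_ord intro: mps_ord_mono)
    moreover have "mps_set_zero (z_vars n \<union> zbar_vars n) (g $ i) = g0 $ i"
      using i c by (simp flip: g)
    moreover have "mps_set_zero (zbar_vars n) (\<phi> $ i) = 0"
      using arg_cong[OF \<phi>, of "\<lambda>v. v $ i"] i c by simp
    ultimately have "g $ i - mps_const \<i> * \<phi> $ i = real_solve (g0 $ i) ((Q *\<^sub>v euler_field n) $ i)"
      using ew[OF i] i real[OF i] by (intro real_solve_unique) (auto simp: h_def simp del: minus_mps.rep_eq)
    then show "h $ i = sol_h Q $ i"
      using i by (simp add: h_def sol_h_def)
  qed (simp add: h_def sol_h_def)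
  have g_eq: "g = sol_g Q" and \<phi>_eq: "\<phi> = sol_phi Q"
    unfolding sol_g_def sol_phi_def h_eq[symmetric]
    using c real by (auto simp: h_def re_im_part_eq intro!: eq_vecI)
  have "struct_b P = A" "struct_w Q = B"
    unfolding struct_b_def struct_w_def fb[symmetric] h_eq[symmetric] \<phi>_eq[symmetric] A B J_def K_def I_def
    by simp_all
  then have "step (P, Q) = (P, Q)"
    using AB(2) by (simp add: step_iff[OF P Q] f_eq[symmetric] g_eq[symmetric])
  with P Q f_eq g_eq \<phi>_eq show thesis
    using that by blast
qed

end

theorem proposition6p2:
  fixes n d :: nat
    and Lb Lw :: "cr_series mat"
    and f0 g0 :: "cr_series vec"
  assumes "formal_almost_CR n d Lb Lw"
    and "f0 \<in> vec_series n (z_vars n \<union> u_vars d)" and "vec_no_constant_linear_terms f0"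
    and "g0 \<in> real_vec_series d (u_vars d)" and "vec_no_constant_linear_terms g0"
  shows "\<exists>!(f, g, \<phi>).
    f \<in> vec_series n (cr_vars n d) \<and> vec_no_constant_linear_terms f \<and>
    g \<in> real_vec_series d (cr_vars n d) \<and> vec_no_constant_linear_terms g \<and>
    \<phi> \<in> real_vec_series d (cr_vars n d) \<and> vec_no_constant_linear_terms \<phi> \<and>
    map_vec (mps_set_zero (zbar_vars n)) f = f0 \<and>
    map_vec (mps_set_zero (z_vars n \<union> zbar_vars n)) g = g0 \<and>
    map_vec (mps_set_zero (zbar_vars n)) \<phi> = 0\<^sub>v d \<and>
    quasi_CR_embedding n d Lb Lw f g \<phi>"
proof -
  interpret normalised_quasi_CR_embedding n d Lb Lw f0 g0
    using assms by unfold_locales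
  obtain X where X: "mcong V 1 0 n n (fst X) (fst X)" "mcong V 1 0 d n (snd X) (snd X)" "step X = X"
    and unique: "\<And>Y. mcong V 1 0 n n (fst Y) (fst Y) \<Longrightarrow> mcong V 1 0 d n (snd Y) (snd Y) \<Longrightarrow>
      step Y = Y \<Longrightarrow> Y = X"
    using step_fixpoint by (elim ex1E conjE) blast
  let ?P = "fst X" and ?Q = "snd X"
  have fp: "step (?P, ?Q) = (?P, ?Q)"
    using X(3) by simp
  note emb = fixpoint_embedding[OF X(1,2) fp]
  \<comment> \<open>Any normalised embedding arises from some fixed point, which must be
    \<open>X\<close>; since its three series are functions of that fixed point, they are
    determined.\<close>
  have eq: "x = (sol_f ?P, sol_g ?Q, sol_phi ?Q)"
    if *: "map_vec (mps_set_zero (zbar_vars n)) (fst x) = f0"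
      "map_vec (mps_set_zero (z_vars n \<union> zbar_vars n)) (fst (snd x)) = g0"
      "map_vec (mps_set_zero (zbar_vars n)) (snd (snd x)) = 0\<^sub>v d"
      "quasi_CR_embedding n d Lb Lw (fst x) (fst (snd x)) (snd (snd x))" for x
  proof -
    obtain P Q where "mcong V 1 0 n n P P" "mcong V 1 0 d n Q Q" "step (P, Q) = (P, Q)"
      and sol: "fst x = sol_f P" "fst (snd x) = sol_g Q" "snd (snd x) = sol_phi Q"
      by (rule embedding_fixpoint[OF *(4,1-3)])
    then have "X = (P, Q)"
      using unique[of "(P, Q)"] by simp
    with sol show ?thesis
      by (simp add: prod_eq_iff)
  qed
  from emb(1) have "sol_f ?P \<in> vec_series n V" "vec_no_constant_linear_terms (sol_f ?P)"
    "sol_g ?Q \<in> real_vec_series d V" "vec_no_constant_linear_terms (sol_g ?Q)"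
    "sol_phi ?Q \<in> real_vec_series d V" "vec_no_constant_linear_terms (sol_phi ?Q)"
    unfolding quasi_CR_embedding_def by blast+
  then show ?thesis
    by (intro ex1I[of _ "(sol_f ?P, sol_g ?Q, sol_phi ?Q)"])
      (use emb in simp, rule eq, simp_all add: case_prod_beta)
qed

end
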